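(* Let $i,j\in\mathbb{N}$. For each oscillating tableau $T=(\lambda^0,\ldots,\lambda^l)$ let $\mathrm{wt}_{i,j}(T):=\sum_{m=0}^{l}|\lambda^m|^i\cdot m^j$. (1) For a fixed nonnegative integer $n$, as $|\lambda|\to\infty$ ($\lambda$ ranging over partitions), $$\frac{1}{\#\mathcal{OT}(\lambda,|\lambda|+2n)}\sum_{T\in\mathcal{OT}(\lambda,|\lambda|+2n)}\mathrm{wt}_{i,j}(T)\ \sim\ \frac{|\lambda|^{i+j+1}}{i+j+1}.$$ (2) For a fixed partition $\lambda$, as $n\to\infty$, $$\frac{1}{\#\mathcal{OT}(\lambda,|\lambda|+2n)}\sum_{T\in\mathcal{OT}(\lambda,|\lambda|+2n)}\mathrm{wt}_{i,j}(T)\ \sim\ \frac{i!\,(i+j)!\,(2n)^{i+j+1}}{(2i+j+1)!}.$$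
   Context: $\mathbb{N}=\{0,1,2,\ldots\}$, and $0^0=1$ (the weight is the evaluation of the monomial $x^iy^j$ at $(|\lambda^m|,m)$). $F\sim G$ means that $F/G\to1$ in the indicated limit; in (1) this means that for every $\varepsilon>0$ there is $K$ such that the ratio is within $\varepsilon$ of $1$ for all partitions $\lambda$ with $|\lambda|\ge K$. A partition is a finite weakly decreasing sequence of positive integers (the empty sequence $\emptyset$ is allowed); its size $|\lambda|$ is the sum of its parts, and it is identified with its Young diagram. An oscillating tableau of shape $\lambda$ and length $l$ is a sequence of partitions $T=(\lambda^0,\lambda^1,\ldots,\lambda^l)$ with $\lambda^0=\emptyset$, $\lambda^l=\lambda$, and, for each $0\le m\le l-1$, $\lambda^{m+1}$ obtained from $\lambda^m$ by adding one box to or removing one box from its Young diagram. $\mathcal{OT}(\lambda,l)$ denotes the set of oscillating tableaux of shape $\lambda$ and length $l$. *)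

theory Defs
  imports Complex_Main "HOL-Library.Landau_Symbols"
begin

text \<open>A partition is the list of its parts; its size is \<^const>\<open>sum_list\<close>.\<close>

definition is_partition :: "nat list \<Rightarrow> bool" where
  "is_partition \<mu> \<longleftrightarrow> sorted_wrt (\<ge>) \<mu> \<and> (\<forall>p\<in>set \<mu>. p > 0)"

definition young_diagram :: "nat list \<Rightarrow> (nat \<times> nat) set" where
  "young_diagram \<mu> = {(r, c). r < length \<mu> \<and> c < \<mu> ! r}"

definition adds_box :: "nat list \<Rightarrow> nat list \<Rightarrow> bool" where
  "adds_box \<mu> \<nu> \<longleftrightarrow> (\<exists>b. b \<notin> young_diagram \<mu> \<and> young_diagram \<nu> = insert b (young_diagram \<mu>))"

text \<open>The second disjunct is the removal of one box from \<^term>\<open>T ! m\<close>.\<close>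

definition oscillating_tableaux :: "nat list \<Rightarrow> nat \<Rightarrow> nat list list set" where
  "oscillating_tableaux \<mu> l =
     {T. length T = l + 1 \<and> (\<forall>m\<le>l. is_partition (T ! m)) \<and> T ! 0 = [] \<and> T ! l = \<mu> \<and>
         (\<forall>m<l. adds_box (T ! m) (T ! Suc m) \<or> adds_box (T ! Suc m) (T ! m))}"

text \<open>In HOL \<open>0 ^ 0 = 1\<close>, as required. A tableau of length \<open>l\<close> is a list of \<open>l + 1\<close> partitions,
  so the sum runs over \<open>0 \<le> m \<le> l\<close>.\<close>

definition wt :: "nat \<Rightarrow> nat \<Rightarrow> nat list list \<Rightarrow> nat" where
  "wt i j T = (\<Sum>m<length T. sum_list (T ! m) ^ i * m ^ j)"

definition average_wt :: "nat \<Rightarrow> nat \<Rightarrow> nat list \<Rightarrow> nat \<Rightarrow> real" where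
  "average_wt i j \<mu> l =
     1 / real (card (oscillating_tableaux \<mu> l)) *
     (\<Sum>T\<in>oscillating_tableaux \<mu> l. real (wt i j T))"

text \<open>The limit in which the size tends to infinity, with the argument ranging over all partitions;
  the lemma below spells it out.\<close>

definition large_partitions :: "nat list filter" where
  "large_partitions = inf (filtercomap sum_list at_top) (principal {\<mu>. is_partition \<mu>})"

lemma eventually_large_partitions:
  "eventually P large_partitions \<longleftrightarrow> (\<exists>K. \<forall>\<mu>. is_partition \<mu> \<and> sum_list \<mu> \<ge> K \<longrightarrow> P \<mu>)"
  unfolding large_partitions_def eventually_inf_principal
    eventually_filtercomap_at_top_linorder
  by auto

end

theory Submission
  imports Defs "HOL-Computational_Algebra.Polynomial"
begin

text \<open>
  In Young's lattice let \<open>U\<close> and \<open>D\<close> be the operators summing over the partitions that cover,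
  respectively are covered by, a given one. Since \<open>D U - U D = 1\<close>, the span of the vectors
  \<open>U\<^sup>k \<emptyset>\<close> is stable under both, and identifying \<open>U\<^sup>k \<emptyset>\<close> with \<open>x\<^sup>k\<close> turns \<open>U + D\<close> into the operator
  \<open>x + d/dx\<close> on polynomials. Hence every sum over \<open>\<O>\<T>(\<lambda>, l)\<close> of a function of the size \<open>|\<lambda>\<^sup>m|\<close> is
  the number of standard tableaux of shape \<open>\<lambda>\<close> times the coefficient of \<open>x\<^bsup>|\<lambda>|\<^esup>\<close> in a polynomial.
  For binomial coefficients of \<open>|\<lambda>\<^sup>m|\<close> the commutation relation makes that coefficient explicit, and its
  sum over \<open>m\<close> is governed by \<open>\<Sum>\<^sub>m (m choose a) (l - m choose b) = (l + 1 choose a + b + 1)\<close>, the discrete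
  beta integral behind \<open>i! (i + j)! / (2 i + j + 1)!\<close>. Powers reduce to binomial coefficients by
  \<open>m (m choose a) = (a + 1) (m choose a + 1) + a (m choose a)\<close>, whose second term is of lower order.

  When only \<open>|\<lambda>|\<close> grows, \<open>m - 2 n \<le> |\<lambda>\<^sup>m| \<le> m\<close> for every tableau, and the average is squeezed between
  two sums of powers.
\<close>

section \<open>Young's lattice\<close>

text \<open>Padding by zeros turns opening a new row and lengthening an old one into the same
  operation, a single function update.\<close>

definition row :: "nat list \<Rightarrow> nat \<Rightarrow> nat" where
  "row \<mu> r = (if r < length \<mu> then \<mu> ! r else 0)"

lemma young_diagram_row: "young_diagram \<mu> = {(r, c). c < row \<mu> r}"
  by (auto simp: young_diagram_def row_def split: if_splits)

lemma antimono_row: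
  assumes "is_partition \<mu>"
  shows "antimono (row \<mu>)"
proof (rule antimonoI)
  fix r s :: nat assume "r \<le> s"
  then show "row \<mu> s \<le> row \<mu> r"
    using assms sorted_wrt_nth_less[of "(\<ge>)" \<mu> r s]
    by (cases "r = s") (auto simp: row_def is_partition_def)
qed

lemma row_pos_iff:
  assumes "is_partition \<mu>"
  shows "0 < row \<mu> r \<longleftrightarrow> r < length \<mu>"
  using assms by (auto simp: row_def is_partition_def)

text \<open>Positive parts make the length recoverable as the first zero of
  \<open>row\<close>.\<close>

lemma row_inject:
  assumes "is_partition \<mu>" "is_partition \<nu>" "row \<mu> = row \<nu>"
  shows "\<mu> = \<nu>"
proof (rule nth_equalityI)
  show len: "length \<mu> = length \<nu>"
    using row_pos_iff[OF assms(1)] row_pos_iff[OF assms(2)] assms(3)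
    by (metis nat_neq_iff)
  show "\<mu> ! r = \<nu> ! r" if "r < length \<mu>" for r
    using that len fun_cong[OF assms(3), of r] by (simp add: row_def)
qed

text \<open>A decreasing function stays zero after its first zero, so listing the values before the
  least zero loses nothing. The new partitions below are built this way.\<close>

lemma ex_partition_row:
  assumes "antimono q" "q N = 0"
  shows "\<exists>\<mu>. is_partition \<mu> \<and> row \<mu> = q"
proof -
  define n where "n = (LEAST r. q r = 0)"
  have qn: "q n = 0" unfolding n_def using assms(2) by (rule LeastI)
  have pos: "0 < q r" if "r < n" for r
    using not_less_Least[of r "\<lambda>r. q r = 0"] that unfolding n_def by simp
  have zero: "q r = 0" if "n \<le> r" for r
    using antimonoD[OF assms(1) that] qn by simp
  define \<mu> where "\<mu> = map q [0..<n]"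
  have "is_partition \<mu>"
    unfolding is_partition_def \<mu>_def
    using pos assms(1) by (auto simp: sorted_wrt_iff_nth_less antimono_def)
  moreover have "row \<mu> = q"
    by (auto simp: row_def \<mu>_def zero)
  ultimately show ?thesis by blast
qed

lemma young_diagram_Sigma: "young_diagram \<mu> = Sigma {..<length \<mu>} (\<lambda>r. {..<\<mu> ! r})"
  by (auto simp: young_diagram_def)

lemma finite_young_diagram [simp]: "finite (young_diagram \<mu>)"
  by (auto simp: young_diagram_Sigma)

lemma card_young_diagram: "card (young_diagram \<mu>) = sum_list \<mu>"
  by (simp add: young_diagram_Sigma sum_list_sum_nth atLeast0LessThan)

lemma adds_box_iff_row:
  "adds_box \<mu> \<nu> \<longleftrightarrow> (\<exists>r. row \<nu> = (row \<mu>)(r := Suc (row \<mu> r)))"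
proof
  assume "adds_box \<mu> \<nu>"
  then obtain r c where b: "(r, c) \<notin> young_diagram \<mu>"
    "young_diagram \<nu> = insert (r, c) (young_diagram \<mu>)"
    unfolding adds_box_def by (metis surj_pair)
  \<comment> \<open>Rows are initial segments, so suitable values of \<open>d\<close> determine
    \<open>row \<nu>\<close>: \<open>d = row \<mu> r\<close> forces the new box to sit at the end of
    row \<open>r\<close>, and \<open>d = Suc c\<close> excludes anything further.\<close>
  have mem: "d < row \<nu> s \<longleftrightarrow> (s = r \<and> d = c) \<or> d < row \<mu> s" for s d
    using b(2) unfolding young_diagram_row by blast
  have "row \<nu> s = row \<mu> s" if "s \<noteq> r" for s
    using mem[of _ s] that by (metis linorder_neqE_nat less_irrefl)
  moreover have "row \<nu> r = Suc (row \<mu> r)"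
  proof -
    have "row \<mu> r \<le> c" using b(1) by (simp add: young_diagram_row)
    moreover have "c < row \<nu> r" using mem[of c r] by simp
    ultimately have "row \<mu> r < row \<nu> r" by linarith
    then have "row \<mu> r = c" using mem[of "row \<mu> r" r] by simp
    moreover have "\<not> Suc c < row \<nu> r"
      using mem[of "Suc c" r] \<open>row \<mu> r \<le> c\<close> by simp
    ultimately show ?thesis using \<open>row \<mu> r < row \<nu> r\<close> by linarith
  qed
  ultimately have "row \<nu> = (row \<mu>)(r := Suc (row \<mu> r))" by auto
  then show "\<exists>r. row \<nu> = (row \<mu>)(r := Suc (row \<mu> r))" ..
next
  assume "\<exists>r. row \<nu> = (row \<mu>)(r := Suc (row \<mu> r))"
  then obtain r where r: "row \<nu> = (row \<mu>)(r := Suc (row \<mu> r))" ..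
  have "young_diagram \<nu> = insert (r, row \<mu> r) (young_diagram \<mu>)"
    by (auto simp: young_diagram_row r split: if_splits)
  then show "adds_box \<mu> \<nu>"
    unfolding adds_box_def by (intro exI[of _ "(r, row \<mu> r)"]) (simp add: young_diagram_row)
qed

lemma adds_box_size: "adds_box \<mu> \<nu> \<Longrightarrow> sum_list \<nu> = Suc (sum_list \<mu>)"
  unfolding adds_box_def by (metis card_insert_disjoint card_young_diagram finite_young_diagram)

section \<open>Covering neighbours and corners\<close>

definition up_nbrs :: "nat list \<Rightarrow> nat list set" where
  "up_nbrs \<mu> = {\<nu>. is_partition \<nu> \<and> adds_box \<mu> \<nu>}"

definition down_nbrs :: "nat list \<Rightarrow> nat list set" where
  "down_nbrs \<mu> = {\<nu>. is_partition \<nu> \<and> adds_box \<nu> \<mu>}"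

lemma up_nbrs_size: "\<nu> \<in> up_nbrs \<mu> \<Longrightarrow> sum_list \<nu> = Suc (sum_list \<mu>)"
  by (simp add: up_nbrs_def adds_box_size)

lemma down_nbrs_size: "\<nu> \<in> down_nbrs \<mu> \<Longrightarrow> sum_list \<mu> = Suc (sum_list \<nu>)"
  by (simp add: down_nbrs_def adds_box_size)

lemma up_nbrs_partition: "\<nu> \<in> up_nbrs \<mu> \<Longrightarrow> is_partition \<nu>"
  by (simp add: up_nbrs_def)

lemma down_nbrs_partition: "\<nu> \<in> down_nbrs \<mu> \<Longrightarrow> is_partition \<nu>"
  by (simp add: down_nbrs_def)

text \<open>Only the comparison of row \<open>r\<close> with the row above it can fail.\<close>

lemma antimono_add_box_iff:
  fixes p :: "nat \<Rightarrow> nat"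
  assumes "antimono p"
  shows "antimono (p(r := Suc (p r))) \<longleftrightarrow> r = 0 \<or> p r < p (r - 1)"
proof
  assume *: "antimono (p(r := Suc (p r)))"
  show "r = 0 \<or> p r < p (r - 1)"
    using antimonoD[OF *, of "r - 1" r] by (cases r) auto
next
  assume r: "r = 0 \<or> p r < p (r - 1)"
  show "antimono (p(r := Suc (p r)))"
  proof (rule antimonoI)
    fix x y :: nat assume xy: "x \<le> y"
    show "(p(r := Suc (p r))) y \<le> (p(r := Suc (p r))) x"
    proof (cases "y = r \<and> x < r")
      case True
      then have "p (r - 1) \<le> p x" by (intro antimonoD[OF assms]) auto
      then show ?thesis using True r by auto
    next
      case False
      then show ?thesis using antimonoD[OF assms xy] xy by auto
    qed
  qed
qed

text \<open>Dually, only the row below matters. The conjunct \<open>0 < p r\<close> excludes the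
  truncated case, in which \<open>p r - 1\<close> changes nothing.\<close>

lemma antimono_remove_box_iff:
  fixes p :: "nat \<Rightarrow> nat"
  assumes "antimono p"
  shows "(0 < p r \<and> antimono (p(r := p r - 1))) \<longleftrightarrow> p (Suc r) < p r"
proof
  assume *: "0 < p r \<and> antimono (p(r := p r - 1))"
  then show "p (Suc r) < p r"
    using antimonoD[of "p(r := p r - 1)" r "Suc r"] by auto
next
  assume r: "p (Suc r) < p r"
  have "antimono (p(r := p r - 1))"
  proof (rule antimonoI)
    fix x y :: nat assume xy: "x \<le> y"
    show "(p(r := p r - 1)) y \<le> (p(r := p r - 1)) x"
    proof (cases "x = r \<and> r < y")
      case True
      then have "p y \<le> p (Suc r)" by (intro antimonoD[OF assms]) auto
      then show ?thesis using True r by auto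
    next
      case False
      then show ?thesis using antimonoD[OF assms xy] xy by auto
    qed
  qed
  then show "0 < p r \<and> antimono (p(r := p r - 1))" using r by auto
qed

lemma up_nbrs_bij:
  assumes "is_partition \<mu>"
  shows "bij_betw row (up_nbrs \<mu>)
    ((\<lambda>r. (row \<mu>)(r := Suc (row \<mu> r))) ` {r. r = 0 \<or> row \<mu> r < row \<mu> (r - 1)})"
  unfolding bij_betw_def
proof
  show "inj_on row (up_nbrs \<mu>)"
    by (auto simp: inj_on_def up_nbrs_def intro: row_inject)
  show "row ` up_nbrs \<mu> = (\<lambda>r. (row \<mu>)(r := Suc (row \<mu> r))) ` {r. r = 0 \<or> row \<mu> r < row \<mu> (r - 1)}"
    (is "?L = ?R")
  proof
    show "?L \<subseteq> ?R"
    proof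
      fix q assume "q \<in> ?L"
      then obtain \<nu> where \<nu>: "is_partition \<nu>" "adds_box \<mu> \<nu>" "q = row \<nu>"
        by (auto simp: up_nbrs_def)
      then obtain r where r: "row \<nu> = (row \<mu>)(r := Suc (row \<mu> r))"
        using adds_box_iff_row by blast
      then show "q \<in> ?R"
        using antimono_add_box_iff[OF antimono_row[OF assms], of r] antimono_row[OF \<nu>(1)] \<nu>(3)
        by auto
    qed
    show "?R \<subseteq> ?L"
    proof
      fix q assume "q \<in> ?R"
      then obtain r where r: "q = (row \<mu>)(r := Suc (row \<mu> r))"
        and *: "r = 0 \<or> row \<mu> r < row \<mu> (r - 1)" by auto
      have "antimono q"
        using antimono_add_box_iff[OF antimono_row[OF assms], of r] * r by simp
      \<comment> \<open>This index lies past the last part and differs from \<open>r\<close>, so the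
        updated function vanishes there.\<close>
      moreover have "q (Suc (length \<mu> + r)) = 0"
        by (simp add: r row_def)
      ultimately obtain \<nu> where \<nu>: "is_partition \<nu>" "row \<nu> = q"
        using ex_partition_row by blast
      then have "adds_box \<mu> \<nu>" using r adds_box_iff_row by blast
      then show "q \<in> ?L" using \<nu> by (auto simp: up_nbrs_def)
    qed
  qed
qed

lemma down_nbrs_bij:
  assumes "is_partition \<mu>"
  shows "bij_betw row (down_nbrs \<mu>)
    ((\<lambda>r. (row \<mu>)(r := row \<mu> r - 1)) ` {r. row \<mu> (Suc r) < row \<mu> r})"
  unfolding bij_betw_def
proof
  show "inj_on row (down_nbrs \<mu>)"
    by (auto simp: inj_on_def down_nbrs_def intro: row_inject)
  show "row ` down_nbrs \<mu> = (\<lambda>r. (row \<mu>)(r := row \<mu> r - 1)) ` {r. row \<mu> (Suc r) < row \<mu> r}"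
    (is "?L = ?R")
  proof
    show "?L \<subseteq> ?R"
    proof
      fix q assume "q \<in> ?L"
      then obtain \<nu> where \<nu>: "is_partition \<nu>" "adds_box \<nu> \<mu>" "q = row \<nu>"
        by (auto simp: down_nbrs_def)
      then obtain r where "row \<mu> = (row \<nu>)(r := Suc (row \<nu> r))"
        using adds_box_iff_row by blast
      then have "q = (row \<mu>)(r := row \<mu> r - 1)" "0 < row \<mu> r"
        using \<nu>(3) by auto
      then show "q \<in> ?R"
        using antimono_remove_box_iff[OF antimono_row[OF assms], of r] antimono_row[OF \<nu>(1)] \<nu>(3)
        by auto
    qed
    show "?R \<subseteq> ?L"
    proof
      fix q assume "q \<in> ?R"
      then obtain r where r: "q = (row \<mu>)(r := row \<mu> r - 1)"
        and *: "row \<mu> (Suc r) < row \<mu> r" by auto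
      have "antimono q"
        using antimono_remove_box_iff[OF antimono_row[OF assms], of r] * r by simp
      moreover have "q (Suc (length \<mu> + r)) = 0"
        by (simp add: r row_def)
      ultimately obtain \<nu> where \<nu>: "is_partition \<nu>" "row \<nu> = q"
        using ex_partition_row by blast
      have "row \<mu> = (row \<nu>)(r := Suc (row \<nu> r))"
        using * by (auto simp: \<nu>(2) r)
      then have "adds_box \<nu> \<mu>" using adds_box_iff_row by blast
      then show "q \<in> ?L" using \<nu> by (auto simp: down_nbrs_def)
    qed
  qed
qed

lemma row_descents_subset: "{r. row \<mu> (Suc r) < row \<mu> r} \<subseteq> {..<length \<mu>}"
  by (auto simp: row_def split: if_splits)

lemma finite_row_descents [simp]: "finite {r. row \<mu> (Suc r) < row \<mu> r}"
  using row_descents_subset finite_subset by blast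

text \<open>Row \<open>Suc r\<close> can grow exactly when row \<open>r\<close> can shrink; row
  \<open>0\<close> can always grow.\<close>

lemma row_ascents_eq:
  "{r. r = 0 \<or> row \<mu> r < row \<mu> (r - 1)} = insert 0 (Suc ` {r. row \<mu> (Suc r) < row \<mu> r})"
proof (intro set_eqI)
  fix r show "r \<in> {r. r = 0 \<or> row \<mu> r < row \<mu> (r - 1)} \<longleftrightarrow>
      r \<in> insert 0 (Suc ` {r. row \<mu> (Suc r) < row \<mu> r})"
    by (cases r) auto
qed

lemma finite_up_nbrs: "is_partition \<mu> \<Longrightarrow> finite (up_nbrs \<mu>)"
  using bij_betw_finite[OF up_nbrs_bij] by (simp only: row_ascents_eq) simp

lemma finite_down_nbrs: "is_partition \<mu> \<Longrightarrow> finite (down_nbrs \<mu>)"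
  using bij_betw_finite[OF down_nbrs_bij] by simp

lemma card_down_nbrs:
  assumes "is_partition \<mu>"
  shows "card (down_nbrs \<mu>) = card {r. row \<mu> (Suc r) < row \<mu> r}"
proof -
  \<comment> \<open>On an empty row the update is the identity; a removable row has positive length,
    so the changed row can be read off.\<close>
  have "inj_on (\<lambda>r. (row \<mu>)(r := row \<mu> r - 1)) {r. row \<mu> (Suc r) < row \<mu> r}"
  proof (rule inj_onI)
    fix r s assume "r \<in> {r. row \<mu> (Suc r) < row \<mu> r}"
      and "(row \<mu>)(r := row \<mu> r - 1) = (row \<mu>)(s := row \<mu> s - 1)"
    then have "row \<mu> r - 1 = ((row \<mu>)(s := row \<mu> s - 1)) r" "row \<mu> (Suc r) < row \<mu> r"
      by (metis fun_upd_same, simp)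
    then show "r = s" by (cases "r = s") auto
  qed
  then show ?thesis
    using bij_betw_same_card[OF down_nbrs_bij[OF assms]] by (simp add: card_image)
qed

text \<open>The surplus of one comes from row \<open>0\<close>. It is the diagonal part of
  \<open>D U - U D = 1\<close>.\<close>

lemma card_up_nbrs:
  assumes "is_partition \<mu>"
  shows "card (up_nbrs \<mu>) = Suc (card (down_nbrs \<mu>))"
proof -
  have "inj (\<lambda>r. (row \<mu>)(r := Suc (row \<mu> r)))"
  proof (rule injI)
    fix r s assume "(row \<mu>)(r := Suc (row \<mu> r)) = (row \<mu>)(s := Suc (row \<mu> s))"
    then have "Suc (row \<mu> r) = ((row \<mu>)(s := Suc (row \<mu> s))) r"
      by (metis fun_upd_same)
    then show "r = s" by (cases "r = s") auto
  qed
  then have "card (up_nbrs \<mu>) = card {r. r = 0 \<or> row \<mu> r < row \<mu> (r - 1)}"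
    using bij_betw_same_card[OF up_nbrs_bij[OF assms]]
    by (simp only: card_image[OF inj_on_subset[OF _ subset_UNIV]])
  also have "\<dots> = Suc (card {r. row \<mu> (Suc r) < row \<mu> r})"
    by (simp only: row_ascents_eq) (simp add: card_image)
  finally show ?thesis by (simp add: card_down_nbrs[OF assms])
qed

text \<open>The last row always ends in a removable corner.\<close>

lemma down_nbrs_nonempty:
  assumes "is_partition \<mu>" "\<mu> \<noteq> []"
  shows "down_nbrs \<mu> \<noteq> {}"
proof -
  have "length \<mu> - 1 \<in> {r. row \<mu> (Suc r) < row \<mu> r}"
    using assms by (auto simp: row_def is_partition_def)
  then have "card {r. row \<mu> (Suc r) < row \<mu> r} \<noteq> 0" by auto
  then show ?thesis using card_down_nbrs[OF assms(1)] by auto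
qed

section \<open>Common neighbours of two partitions\<close>

text \<open>Distinct partitions with a common cover differ by moving one box. The cover is then the
  union of the diagrams, and the intersection is covered by both.\<close>

lemma common_up_nbr:
  assumes "\<mu> \<noteq> \<rho>" "is_partition \<mu>" "is_partition \<rho>" "\<tau> \<in> up_nbrs \<mu> \<inter> up_nbrs \<rho>"
  shows "row \<tau> = (\<lambda>x. max (row \<mu> x) (row \<rho> x))"
    and "\<exists>\<sigma>. \<sigma> \<in> down_nbrs \<mu> \<inter> down_nbrs \<rho>"
proof -
  obtain r s where r: "row \<tau> = (row \<mu>)(r := Suc (row \<mu> r))"
    and s: "row \<tau> = (row \<rho>)(s := Suc (row \<rho> s))"
    using assms(4) by (auto simp: up_nbrs_def adds_box_iff_row)
  have "r \<noteq> s"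
  proof
    assume "r = s"
    with r s have "row \<mu> x = row \<rho> x" for x
      by (metis fun_upd_apply old.nat.inject)
    then show False using row_inject[OF assms(2,3)] assms(1) by blast
  qed
  have \<mu>r: "row \<rho> r = Suc (row \<mu> r)" and \<mu>s: "row \<mu> s = Suc (row \<rho> s)"
    and eq: "\<And>x. x \<noteq> r \<Longrightarrow> x \<noteq> s \<Longrightarrow> row \<mu> x = row \<rho> x"
    using r s \<open>r \<noteq> s\<close> by (metis fun_upd_apply)+
  show "row \<tau> = (\<lambda>x. max (row \<mu> x) (row \<rho> x))"
  proof
    fix x show "row \<tau> x = max (row \<mu> x) (row \<rho> x)"
      using r \<mu>r \<mu>s eq[of x] by (cases "x = r"; cases "x = s") auto
  qed
  have "antimono (\<lambda>x. min (row \<mu> x) (row \<rho> x))"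
    by (intro antimonoI min.mono antimonoD[OF antimono_row[OF assms(2)]] antimonoD[OF antimono_row[OF assms(3)]])
  moreover have "min (row \<mu> (length \<mu>)) (row \<rho> (length \<mu>)) = 0"
    by (simp add: row_def)
  ultimately obtain \<sigma> where \<sigma>: "is_partition \<sigma>" "row \<sigma> = (\<lambda>x. min (row \<mu> x) (row \<rho> x))"
    using ex_partition_row by blast
  have "row \<mu> = (row \<sigma>)(s := Suc (row \<sigma> s))"
  proof
    fix x show "row \<mu> x = ((row \<sigma>)(s := Suc (row \<sigma> s))) x"
      using \<mu>r \<mu>s eq[of x] by (cases "x = r"; cases "x = s") (auto simp: \<sigma>(2))
  qed
  moreover have "row \<rho> = (row \<sigma>)(r := Suc (row \<sigma> r))"
  proof
    fix x show "row \<rho> x = ((row \<sigma>)(r := Suc (row \<sigma> r))) x"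
      using \<mu>r \<mu>s eq[of x] by (cases "x = r"; cases "x = s") (auto simp: \<sigma>(2))
  qed
  ultimately show "\<exists>\<sigma>. \<sigma> \<in> down_nbrs \<mu> \<inter> down_nbrs \<rho>"
    using \<sigma>(1) by (auto simp: down_nbrs_def adds_box_iff_row)
qed

text \<open>The same square read from below: the intersection is the only candidate, and the union
  closes the square.\<close>

lemma common_down_nbr:
  assumes "\<mu> \<noteq> \<rho>" "is_partition \<mu>" "is_partition \<rho>" "\<sigma> \<in> down_nbrs \<mu> \<inter> down_nbrs \<rho>"
  shows "row \<sigma> = (\<lambda>x. min (row \<mu> x) (row \<rho> x))"
    and "\<exists>\<tau>. \<tau> \<in> up_nbrs \<mu> \<inter> up_nbrs \<rho>"
proof -
  obtain r s where r: "row \<mu> = (row \<sigma>)(r := Suc (row \<sigma> r))"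
    and s: "row \<rho> = (row \<sigma>)(s := Suc (row \<sigma> s))"
    using assms(4) by (auto simp: down_nbrs_def adds_box_iff_row)
  have "r \<noteq> s"
    using r s row_inject[OF assms(2,3)] assms(1) by metis
  show "row \<sigma> = (\<lambda>x. min (row \<mu> x) (row \<rho> x))"
    using \<open>r \<noteq> s\<close> by (auto simp: r s)
  have "antimono (\<lambda>x. max (row \<mu> x) (row \<rho> x))"
    by (intro antimonoI max.mono antimonoD[OF antimono_row[OF assms(2)]] antimonoD[OF antimono_row[OF assms(3)]])
  \<comment> \<open>The maximum vanishes only where both functions do, hence an index beyond both
    lengths.\<close>
  moreover have "max (row \<mu> (length \<mu> + length \<rho>)) (row \<rho> (length \<mu> + length \<rho>)) = 0"
    by (simp add: row_def)
  ultimately obtain \<tau> where \<tau>: "is_partition \<tau>" "row \<tau> = (\<lambda>x. max (row \<mu> x) (row \<rho> x))"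
    using ex_partition_row by blast
  have "row \<tau> = (row \<mu>)(s := Suc (row \<mu> s))" "row \<tau> = (row \<rho>)(r := Suc (row \<rho> r))"
    using \<open>r \<noteq> s\<close> by (auto simp: \<tau>(2) r s)
  then have "adds_box \<mu> \<tau>" "adds_box \<rho> \<tau>"
    using adds_box_iff_row by blast+
  then show "\<exists>\<tau>. \<tau> \<in> up_nbrs \<mu> \<inter> up_nbrs \<rho>"
    using \<tau>(1) by (auto simp: up_nbrs_def)
qed

text \<open>The off-diagonal part of \<open>D U - U D = 1\<close>: each intersection has at most one
  element, and one is nonempty exactly when the other is.\<close>

lemma card_common_nbrs:
  assumes "\<mu> \<noteq> \<rho>" "is_partition \<mu>" "is_partition \<rho>"
  shows "card (up_nbrs \<mu> \<inter> up_nbrs \<rho>) = card (down_nbrs \<mu> \<inter> down_nbrs \<rho>)"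
proof -
  have "\<exists>\<tau>. up_nbrs \<mu> \<inter> up_nbrs \<rho> = {\<tau>}" if "up_nbrs \<mu> \<inter> up_nbrs \<rho> \<noteq> {}"
    using that common_up_nbr(1)[OF assms] row_inject up_nbrs_partition
    by (metis (no_types, lifting) IntD1 ex_in_conv is_singletonI' is_singleton_def)
  moreover have "\<exists>\<sigma>. down_nbrs \<mu> \<inter> down_nbrs \<rho> = {\<sigma>}" if "down_nbrs \<mu> \<inter> down_nbrs \<rho> \<noteq> {}"
    using that common_down_nbr(1)[OF assms] row_inject down_nbrs_partition
    by (metis (no_types, lifting) IntD1 ex_in_conv is_singletonI' is_singleton_def)
  ultimately show ?thesis
    using common_up_nbr(2)[OF assms] common_down_nbr(2)[OF assms]
    by (cases "up_nbrs \<mu> \<inter> up_nbrs \<rho> = {}"; cases "down_nbrs \<mu> \<inter> down_nbrs \<rho> = {}") auto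
qed

section \<open>The operator \<open>x + d/dx\<close>\<close>

definition walk_op :: "real poly \<Rightarrow> real poly" where
  "walk_op p = pCons 0 p + pderiv p"

text \<open>These are the probabilists' Hermite polynomials with all signs made positive; the
  coefficient of \<open>x^k\<close> counts the partial matchings of \<open>m\<close> points that
  leave \<open>k\<close> points unmatched.\<close>

definition hpoly :: "nat \<Rightarrow> real poly" where
  "hpoly m = (walk_op ^^ m) 1"

lemma coeff_walk_op: "coeff (walk_op p) k = (if k = 0 then 0 else coeff p (k - 1)) + real (Suc k) * coeff p (Suc k)"
  by (cases k) (simp_all add: walk_op_def coeff_pderiv)

lemma smult_sum_right: "smult c (sum f S) = (\<Sum>x\<in>S. smult c (f x))"
  by (induction S rule: infinite_finite_induct) (simp_all add: smult_add_right)

lemma walk_op_add: "walk_op (p + q) = walk_op p + walk_op q"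
  by (simp add: walk_op_def pderiv_add)

lemma walk_op_smult: "walk_op (smult c p) = smult c (walk_op p)"
  by (simp add: walk_op_def pderiv_smult smult_add_right)

lemma walk_op_0 [simp]: "walk_op 0 = 0"
  by (simp add: walk_op_def)

lemma walk_op_pow_smult: "(walk_op ^^ r) (smult c p) = smult c ((walk_op ^^ r) p)"
  by (induction r) (simp_all add: walk_op_smult)

text \<open>The commutator of \<open>d/dx\<close> with \<open>walk_op\<close> is the identity, so
  passing \<open>r\<close> factors leaves \<open>r\<close> copies of the power \<open>r - 1\<close>.
  At \<open>r = 0\<close> the factor \<open>real r\<close> masks the truncated exponent.\<close>

lemma pderiv_walk_op_pow:
  "pderiv ((walk_op ^^ r) p) = (walk_op ^^ r) (pderiv p) + smult (real r) ((walk_op ^^ (r - 1)) p)"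
proof (induction r)
  case (Suc r)
  have "pderiv (walk_op q) = walk_op (pderiv q) + q" for q
    by (simp add: walk_op_def pderiv_pCons pderiv_add algebra_simps)
  moreover have "walk_op (smult (real r) ((walk_op ^^ (r - 1)) p)) = smult (real r) ((walk_op ^^ r) p)"
    by (cases r) (simp_all add: walk_op_smult)
  ultimately show ?case by (simp add: Suc walk_op_add smult_add_left)
qed simp

section \<open>Derivatives and coefficients of \<open>hpoly\<close>\<close>

text \<open>The derivative annihilates the starting polynomial \<open>1\<close>, so only the
  commutator term remains: an Appell sequence.\<close>

lemma pderiv_hpoly: "pderiv (hpoly m) = smult (real m) (hpoly (m - 1))"
proof -
  have "(walk_op ^^ m) 0 = 0" by (induction m) simp_all
  then show ?thesis by (simp add: hpoly_def pderiv_walk_op_pow)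
qed

lemma coeff_hpoly_Suc: "real (Suc k) * coeff (hpoly m) (Suc k) = real m * coeff (hpoly (m - 1)) k"
  by (metis pderiv_hpoly coeff_pderiv coeff_smult of_nat_Suc)

lemma coeff_hpoly_0: "coeff (hpoly (2 * n)) 0 = fact (2 * n) / (fact n * 2 ^ n)"
proof (induction n)
  case (Suc n)
  \<comment> \<open>Multiplication by \<open>x\<close> contributes nothing to a constant term, so it
    comes from \<open>d/dx\<close> alone.\<close>
  have "coeff (hpoly (2 * Suc n)) 0 = coeff (hpoly (2 * n + 1)) 1"
    by (simp add: hpoly_def coeff_walk_op)
  also have "\<dots> = real (2 * n + 1) * coeff (hpoly (2 * n)) 0"
    using coeff_hpoly_Suc[of 0 "2 * n + 1"] by simp
  also have "\<dots> = fact (2 * Suc n) / (fact (Suc n) * 2 ^ Suc n)"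
    unfolding Suc by (simp add: divide_simps)
  finally show ?case .
qed (simp add: hpoly_def)

text \<open>\<open>coeff_hpoly_Suc\<close> lowers degree and index together and keeps
  \<open>n\<close>, so everything reduces to the constant term.\<close>

lemma coeff_hpoly: "coeff (hpoly (k + 2 * n)) k = fact (k + 2 * n) / (fact k * fact n * 2 ^ n)"
proof (induction k)
  case (Suc k)
  have "real (Suc k) * coeff (hpoly (Suc k + 2 * n)) (Suc k)
      = real (Suc k + 2 * n) * (fact (k + 2 * n) / (fact k * fact n * 2 ^ n))"
    using coeff_hpoly_Suc[of k "Suc k + 2 * n"] Suc by simp
  then show ?case by (simp add: field_simps del: of_nat_Suc of_nat_add)
qed (simp add: coeff_hpoly_0)

text \<open>Weighting coefficients by \<open>k choose a\<close> is the operator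
  \<open>x^a (d/dx)^a / a!\<close>, and each derivative lowers the index of \<open>hpoly\<close> by
  one. When \<open>m - a\<close> truncates, \<open>m choose a\<close> is zero.\<close>

lemma choose_coeff_hpoly:
  "real (k choose a) * coeff (hpoly m) k = real (m choose a) * coeff (monom 1 a * hpoly (m - a)) k"
proof (induction a arbitrary: k m)
  case (Suc a)
  show ?case
  proof (cases "k = 0 \<or> m = 0")
    case True
    moreover have "coeff (hpoly 0) k = 0" if "k \<noteq> 0" using that by (simp add: hpoly_def)
    ultimately show ?thesis by (auto simp: coeff_monom_mult)
  next
    case False
    then obtain k' m' where [simp]: "k = Suc k'" "m = Suc m'" by (metis not0_implies_Suc)
    \<comment> \<open>Both sides are compared after multiplication by \<open>Suc a\<close>, which
      absorption converts into \<open>Suc k'\<close> and \<open>Suc m'\<close>.\<close>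
    have absorb: "real (Suc a) * real (Suc x choose Suc a) = real (Suc x) * real (x choose a)" for x
      using Suc_times_binomial_eq[of x a] by (simp only: mult.commute flip: of_nat_mult)
    have "real (Suc a) * (real (k choose Suc a) * coeff (hpoly m) k)
        = real (k' choose a) * (real (Suc k') * coeff (hpoly m) (Suc k'))"
      using absorb[of k'] by (simp del: of_nat_Suc binomial_Suc_Suc add: mult.assoc[symmetric])
    also have "\<dots> = real (Suc m') * (real (k' choose a) * coeff (hpoly m') k')"
      using coeff_hpoly_Suc[of k' m] by simp
    also have "\<dots> = real (Suc m') * real (m' choose a) * coeff (monom 1 (Suc a) * hpoly (m - Suc a)) k"
      by (simp add: Suc coeff_monom_mult del: of_nat_Suc)
    also have "\<dots> = real (Suc a) * (real (m choose Suc a) * coeff (monom 1 (Suc a) * hpoly (m - Suc a)) k)"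
      using absorb[of m'] by (simp del: of_nat_Suc binomial_Suc_Suc add: mult.assoc[symmetric])
    finally show ?thesis by (simp del: of_nat_Suc)
  qed
qed simp

section \<open>Moving powers of the operator past powers of \<open>x\<close>\<close>

lemma walk_op_pow_pCons:
  "(walk_op ^^ r) (pCons 0 p) = pCons 0 ((walk_op ^^ r) p) + smult (real r) ((walk_op ^^ (r - 1)) p)"
proof (induction r)
  case (Suc r)
  have "walk_op (pCons 0 q) = pCons 0 (walk_op q) + q" for q
    by (simp add: walk_op_def pderiv_pCons)
  moreover have "walk_op (smult (real r) ((walk_op ^^ (r - 1)) p)) = smult (real r) ((walk_op ^^ r) p)"
    by (cases r) (simp_all add: walk_op_smult)
  ultimately show ?case by (simp add: Suc walk_op_add smult_add_left)
qed simp

text \<open>Each factor \<open>x\<close> either passes every \<open>walk_op\<close> or cancels one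
  of them through the commutator. With \<open>s\<close> cancelling factors there are
  \<open>a choose s\<close> choices times the falling factorial
  \<open>fact s * (r choose s)\<close>, which is zero when \<open>r - s\<close> truncates.\<close>

lemma walk_op_pow_monom:
  "(walk_op ^^ r) (monom 1 a * p) =
     (\<Sum>s\<le>a. smult (real ((a choose s) * fact s * (r choose s))) (monom 1 (a - s) * (walk_op ^^ (r - s)) p))"
proof (induction a arbitrary: r)
  case (Suc a)
  \<comment> \<open>The family is set up for exponent \<open>Suc a\<close>, so that the two halves
    of the recursion are its members at \<open>s\<close> and at \<open>Suc s\<close>.\<close>
  define t where "t r s = smult (real (fact s * (r choose s))) (monom 1 (Suc a - s) * (walk_op ^^ (r - s)) p)" for r s
  have ff: "real r * real (fact s * (r - 1 choose s)) = real (fact (Suc s) * (r choose Suc s))" for s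
    using Suc_times_binomial_eq[of "r - 1" s]
    by (cases r) (simp_all del: of_nat_Suc binomial_Suc_Suc add: algebra_simps flip: of_nat_mult)
  have "(walk_op ^^ r) (monom 1 (Suc a) * p) = (walk_op ^^ r) (pCons 0 (monom 1 a * p))"
    by (simp add: monom_Suc)
  also have "\<dots> = pCons 0 ((walk_op ^^ r) (monom 1 a * p)) + smult (real r) ((walk_op ^^ (r - 1)) (monom 1 a * p))"
    by (rule walk_op_pow_pCons)
  also have "pCons 0 ((walk_op ^^ r) (monom 1 a * p)) = monom 1 1 * ((walk_op ^^ r) (monom 1 a * p))"
    by (simp add: monom_altdef)
  also have "\<dots> = (\<Sum>s\<le>a. smult (real (a choose s)) (t r s))"
    unfolding Suc sum_distrib_left t_def
    by (intro sum.cong refl) (simp add: mult_monom Suc_diff_le mult.assoc[symmetric])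
  also have "smult (real r) ((walk_op ^^ (r - 1)) (monom 1 a * p)) = (\<Sum>s\<le>a. smult (real (a choose s)) (t r (Suc s)))"
    unfolding Suc smult_sum_right t_def smult_smult
  proof (intro sum.cong refl)
    fix s
    have "real r * real ((a choose s) * fact s * (r - 1 choose s)) = real (a choose s) * real (fact (Suc s) * (r choose Suc s))"
      unfolding ff[symmetric] by simp
    moreover have "r - 1 - s = r - Suc s" "Suc a - Suc s = a - s" by simp_all
    ultimately show "smult (real r * real ((a choose s) * fact s * (r - 1 choose s))) (monom 1 (a - s) * (walk_op ^^ (r - 1 - s)) p) =
        smult (real (a choose s) * real (fact (Suc s) * (r choose Suc s))) (monom 1 (Suc a - Suc s) * (walk_op ^^ (r - Suc s)) p)"
      by (simp only:)
  qed
  also have "(\<Sum>s\<le>a. smult (real (a choose s)) (t r s)) + (\<Sum>s\<le>a. smult (real (a choose s)) (t r (Suc s)))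
      = (\<Sum>s\<le>Suc a. smult (real (Suc a choose s)) (t r s))"
  \<comment> \<open>Pascal's rule; the first sum may be extended to \<open>s = Suc a\<close> because
    \<open>a choose Suc a\<close> is zero.\<close>
  proof -
    have "(\<Sum>s\<le>a. smult (real (a choose s)) (t r s)) = (\<Sum>s\<le>Suc a. smult (real (a choose s)) (t r s))"
      by simp
    also have "\<dots> = t r 0 + (\<Sum>s\<le>a. smult (real (a choose Suc s)) (t r (Suc s)))"
      by (subst sum.atMost_Suc_shift) simp
    finally show ?thesis
      by (subst sum.atMost_Suc_shift)
        (simp add: smult_add_left sum.distrib add.assoc add.commute)
  qed
  finally show ?case by (simp add: t_def mult.assoc)
qed simp

section \<open>Oscillating tableaux\<close>

lemma oscillating_tableaux_partition:
  "T \<in> oscillating_tableaux \<mu> l \<Longrightarrow> is_partition \<mu>"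
  by (auto simp: oscillating_tableaux_def)

lemma oscillating_tableaux_0:
  "oscillating_tableaux \<mu> 0 = (if \<mu> = [] then {[[]]} else {})"
  by (auto simp: oscillating_tableaux_def length_Suc_conv is_partition_def)

lemma oscillating_tableaux_Suc:
  assumes "is_partition \<mu>"
  shows "oscillating_tableaux \<mu> (Suc l) =
    (\<Union>\<nu>\<in>up_nbrs \<mu> \<union> down_nbrs \<mu>. (\<lambda>T. T @ [\<mu>]) ` oscillating_tableaux \<nu> l)"
proof (intro set_eqI iffI)
  fix T assume T: "T \<in> oscillating_tableaux \<mu> (Suc l)"
  then have len: "length T = Suc (Suc l)" by (simp add: oscillating_tableaux_def)
  have Tl: "T ! Suc l = \<mu>" using T by (simp add: oscillating_tableaux_def)
  define S where "S = butlast T"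
  have TS: "T = S @ [\<mu>]"
    unfolding S_def using len Tl
    by (metis append_butlast_last_id diff_Suc_1 last_conv_nth length_0_conv nat.distinct(1))
  have lenS: "length S = Suc l" using len TS by simp
  have nth: "T ! m = S ! m" if "m \<le> l" for m
    using that lenS by (simp add: TS nth_append)
  have "S \<in> oscillating_tableaux (S ! l) l"
    unfolding oscillating_tableaux_def
  proof (intro CollectI conjI allI impI)
    show "length S = l + 1" using lenS by simp
    show "is_partition (S ! m)" if "m \<le> l" for m
      using T that by (simp add: oscillating_tableaux_def flip: nth)
    show "S ! 0 = []" using T by (simp add: oscillating_tableaux_def flip: nth)
    show "S ! l = S ! l" ..
    show "adds_box (S ! m) (S ! Suc m) \<or> adds_box (S ! Suc m) (S ! m)" if "m < l" for m
      using T that by (simp add: oscillating_tableaux_def flip: nth)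
  qed
  moreover have "adds_box (T ! l) (T ! Suc l) \<or> adds_box (T ! Suc l) (T ! l)" "is_partition (T ! l)"
    using T by (auto simp: oscillating_tableaux_def)
  then have "S ! l \<in> up_nbrs \<mu> \<union> down_nbrs \<mu>"
    by (auto simp: Tl nth up_nbrs_def down_nbrs_def)
  ultimately show "T \<in> (\<Union>\<nu>\<in>up_nbrs \<mu> \<union> down_nbrs \<mu>. (\<lambda>T. T @ [\<mu>]) ` oscillating_tableaux \<nu> l)"
    using TS by blast
next
  fix T assume "T \<in> (\<Union>\<nu>\<in>up_nbrs \<mu> \<union> down_nbrs \<mu>. (\<lambda>T. T @ [\<mu>]) ` oscillating_tableaux \<nu> l)"
  then obtain \<nu> S where \<nu>: "\<nu> \<in> up_nbrs \<mu> \<union> down_nbrs \<mu>" and S: "S \<in> oscillating_tableaux \<nu> l"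
    and TS: "T = S @ [\<mu>]" by blast
  have lenS: "length S = Suc l" and Sl: "S ! l = \<nu>" using S by (auto simp: oscillating_tableaux_def)
  have nth: "T ! m = S ! m" if "m \<le> l" for m
    using that lenS by (simp add: TS nth_append)
  have Tl: "T ! Suc l = \<mu>" using lenS by (simp add: TS nth_append)
  show "T \<in> oscillating_tableaux \<mu> (Suc l)"
    unfolding oscillating_tableaux_def
  proof (intro CollectI conjI allI impI)
    show "length T = Suc l + 1" using lenS TS by simp
    show "is_partition (T ! m)" if "m \<le> Suc l" for m
      using that S assms nth Tl by (cases "m = Suc l") (auto simp: oscillating_tableaux_def)
    show "T ! 0 = []" using nth[of 0] S by (simp add: oscillating_tableaux_def)
    show "T ! Suc l = \<mu>" by (rule Tl)
    show "adds_box (T ! m) (T ! Suc m) \<or> adds_box (T ! Suc m) (T ! m)" if "m < Suc l" for m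
    proof (cases "m = l")
      case True
      then show ?thesis using \<nu> by (auto simp: Tl nth Sl up_nbrs_def down_nbrs_def)
    next
      case False
      then show ?thesis using S that nth[of m] nth[of "Suc m"] by (auto simp: oscillating_tableaux_def)
    qed
  qed
qed

lemma finite_oscillating_tableaux: "finite (oscillating_tableaux \<mu> l)"
proof (induction l arbitrary: \<mu>)
  case (Suc l)
  show ?case
  proof (cases "is_partition \<mu>")
    case True
    then show ?thesis
      using Suc by (simp add: oscillating_tableaux_Suc finite_up_nbrs finite_down_nbrs)
  qed (use oscillating_tableaux_partition in \<open>metis finite.emptyI all_not_in_conv\<close>)
qed (simp add: oscillating_tableaux_0)

lemma sum_oscillating_tableaux_Suc:
  assumes "is_partition \<mu>"
  shows "(\<Sum>T\<in>oscillating_tableaux \<mu> (Suc l). g T) =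
    (\<Sum>\<nu>\<in>up_nbrs \<mu>. \<Sum>T\<in>oscillating_tableaux \<nu> l. g (T @ [\<mu>])) +
    (\<Sum>\<nu>\<in>down_nbrs \<mu>. \<Sum>T\<in>oscillating_tableaux \<nu> l. g (T @ [\<mu>]))"
proof -
  have disj: "(\<lambda>T. T @ [\<mu>]) ` oscillating_tableaux \<nu> l \<inter> (\<lambda>T. T @ [\<mu>]) ` oscillating_tableaux \<nu>' l = {}"
    if "\<nu> \<noteq> \<nu>'" for \<nu> \<nu>'
    using that by (auto simp: oscillating_tableaux_def)
  \<comment> \<open>The sizes of the two kinds of neighbour differ by two.\<close>
  have "up_nbrs \<mu> \<inter> down_nbrs \<mu> = {}"
    using up_nbrs_size[of _ \<mu>] down_nbrs_size[of _ \<mu>] by fastforce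
  moreover have "(\<Sum>T\<in>oscillating_tableaux \<mu> (Suc l). g T) =
    (\<Sum>\<nu>\<in>up_nbrs \<mu> \<union> down_nbrs \<mu>. \<Sum>T\<in>(\<lambda>T. T @ [\<mu>]) ` oscillating_tableaux \<nu> l. g T)"
    unfolding oscillating_tableaux_Suc[OF assms] using assms disj
    by (intro sum.UNION_disjoint)
      (auto simp: finite_up_nbrs finite_down_nbrs finite_oscillating_tableaux)
  moreover have "(\<Sum>T\<in>(\<lambda>T. T @ [\<mu>]) ` oscillating_tableaux \<nu> l. g T) =
      (\<Sum>T\<in>oscillating_tableaux \<nu> l. g (T @ [\<mu>]))" for \<nu>
    by (subst sum.reindex) (auto simp: inj_on_def)
  ultimately show ?thesis
    using assms by (simp add: sum.union_disjoint finite_up_nbrs finite_down_nbrs)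
qed

section \<open>Size bounds\<close>

lemma oscillating_tableaux_size_step:
  assumes "T \<in> oscillating_tableaux \<mu> l" "m < l"
  shows "sum_list (T ! Suc m) \<le> Suc (sum_list (T ! m))"
  using assms adds_box_size[of "T ! m" "T ! Suc m"] adds_box_size[of "T ! Suc m" "T ! m"]
  by (auto simp: oscillating_tableaux_def)

lemma oscillating_tableaux_size_le:
  assumes "T \<in> oscillating_tableaux \<mu> l" "m + d \<le> l"
  shows "sum_list (T ! (m + d)) \<le> sum_list (T ! m) + d"
  using assms(2)
proof (induction d)
  case (Suc d)
  then show ?case using oscillating_tableaux_size_step[OF assms(1), of "m + d"] by simp
qed simp

text \<open>Size grows by at most one per step; this is applied from the empty start to
  \<open>m\<close>, and from \<open>m\<close> to the end.\<close>

lemma oscillating_tableaux_size_bounds: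
  assumes "T \<in> oscillating_tableaux \<mu> l" "m \<le> l"
  shows "sum_list (T ! m) \<le> m" "sum_list \<mu> \<le> sum_list (T ! m) + (l - m)"
proof -
  have "T ! 0 = []" "T ! l = \<mu>" using assms(1) by (auto simp: oscillating_tableaux_def)
  then show "sum_list (T ! m) \<le> m" "sum_list \<mu> \<le> sum_list (T ! m) + (l - m)"
    using oscillating_tableaux_size_le[OF assms(1), of 0 m]
      oscillating_tableaux_size_le[OF assms(1), of m "l - m"] assms(2) by auto
qed

lemma oscillating_tableaux_empty:
  assumes "l < sum_list \<mu>"
  shows "oscillating_tableaux \<mu> l = {}"
  using oscillating_tableaux_size_bounds(1)[of _ \<mu> l l] assms
  by (fastforce simp: oscillating_tableaux_def)

section \<open>Standard tableaux and the commutation relation\<close>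

text \<open>At the minimal length every step adds a box, so these are the standard tableaux.\<close>

definition num_syt :: "nat list \<Rightarrow> nat" where
  "num_syt \<mu> = card (oscillating_tableaux \<mu> (sum_list \<mu>))"

lemma partition_size_0_iff: "is_partition \<mu> \<Longrightarrow> sum_list \<mu> = 0 \<longleftrightarrow> \<mu> = []"
  by (cases \<mu>) (auto simp: is_partition_def)

lemma num_syt_Nil [simp]: "num_syt [] = 1"
  by (simp add: num_syt_def oscillating_tableaux_0)

lemma num_syt_eq_sum_down:
  assumes "is_partition \<mu>" "\<mu> \<noteq> []"
  shows "num_syt \<mu> = (\<Sum>\<nu>\<in>down_nbrs \<mu>. num_syt \<nu>)"
proof -
  obtain k where k: "sum_list \<mu> = Suc k"
    using assms partition_size_0_iff not0_implies_Suc by blast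
  have "num_syt \<mu> = (\<Sum>T\<in>oscillating_tableaux \<mu> (Suc k). 1)"
    by (simp add: num_syt_def k)
  also have "\<dots> = (\<Sum>\<nu>\<in>up_nbrs \<mu>. card (oscillating_tableaux \<nu> k))
      + (\<Sum>\<nu>\<in>down_nbrs \<mu>. card (oscillating_tableaux \<nu> k))"
    unfolding sum_oscillating_tableaux_Suc[OF assms(1)] by simp
  \<comment> \<open>These neighbours have size \<open>Suc (Suc k)\<close>, out of reach in
    \<open>k\<close> steps.\<close>
  also have "(\<Sum>\<nu>\<in>up_nbrs \<mu>. card (oscillating_tableaux \<nu> k)) = 0"
    using up_nbrs_size[of _ \<mu>] k by (simp add: oscillating_tableaux_empty)
  also have "(\<Sum>\<nu>\<in>down_nbrs \<mu>. card (oscillating_tableaux \<nu> k)) = (\<Sum>\<nu>\<in>down_nbrs \<mu>. num_syt \<nu>)"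
    using down_nbrs_size[of _ \<mu>] k by (intro sum.cong) (auto simp: num_syt_def)
  finally show ?thesis by simp
qed

lemma down_nbrs_Nil [simp]: "down_nbrs [] = {}"
  using down_nbrs_size[of _ "[]"] by fastforce

lemma num_syt_pos:
  assumes "is_partition \<mu>"
  shows "0 < num_syt \<mu>"
  using assms
proof (induction "sum_list \<mu>" arbitrary: \<mu> rule: less_induct)
  case less
  show ?case
  proof (cases "\<mu> = []")
    case False
    have "0 < num_syt \<nu>" if "\<nu> \<in> down_nbrs \<mu>" for \<nu>
      using less.hyps[of \<nu>] down_nbrs_size[OF that] down_nbrs_partition[OF that] by simp
    then show ?thesis
      using num_syt_eq_sum_down[OF less.prems False] down_nbrs_nonempty[OF less.prems False]
        finite_down_nbrs[OF less.prems] by (simp add: sum_pos)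
  qed simp
qed

text \<open>This is \<open>D U = U D + 1\<close> applied to \<open>f\<close>, assembled from
  \<open>card_up_nbrs\<close> on the diagonal and \<open>card_common_nbrs\<close> off it.\<close>

lemma sum_up_down_swap:
  fixes f :: "nat list \<Rightarrow> nat"
  assumes "is_partition \<mu>"
  shows "(\<Sum>\<nu>\<in>up_nbrs \<mu>. \<Sum>\<rho>\<in>down_nbrs \<nu>. f \<rho>) = f \<mu> + (\<Sum>\<nu>\<in>down_nbrs \<mu>. \<Sum>\<rho>\<in>up_nbrs \<nu>. f \<rho>)"
proof -
  \<comment> \<open>\<open>R\<close> holds every partition reached on either side, so both double
    sums become sums over \<open>R\<close> weighted by numbers of common neighbours.\<close>
  define R where "R = (\<Union>\<nu>\<in>up_nbrs \<mu>. down_nbrs \<nu>) \<union> (\<Union>\<nu>\<in>down_nbrs \<mu>. up_nbrs \<nu>) \<union> {\<mu>}"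
  have part: "is_partition \<rho>" if "\<rho> \<in> R" for \<rho>
    using that assms by (auto simp: R_def up_nbrs_def down_nbrs_def)
  have fin: "finite R"
    unfolding R_def using assms
    by (auto simp: finite_up_nbrs finite_down_nbrs up_nbrs_partition down_nbrs_partition)
  have restrict: "(\<Sum>\<rho>\<in>A. f \<rho>) = (\<Sum>\<rho>\<in>R. if \<rho> \<in> A then f \<rho> else 0)" if "A \<subseteq> R" for A
    using sum.inter_restrict[OF fin, of f A] that by (simp add: Int_absorb1)
  have up: "up_nbrs \<mu> \<inter> {\<nu>. \<rho> \<in> down_nbrs \<nu>} = up_nbrs \<mu> \<inter> up_nbrs \<rho>"
    and down: "down_nbrs \<mu> \<inter> {\<nu>. \<rho> \<in> up_nbrs \<nu>} = down_nbrs \<mu> \<inter> down_nbrs \<rho>" if "\<rho> \<in> R" for \<rho>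
    using part[OF that] by (auto simp: up_nbrs_def down_nbrs_def)
  have "(\<Sum>\<nu>\<in>up_nbrs \<mu>. \<Sum>\<rho>\<in>down_nbrs \<nu>. f \<rho>) = (\<Sum>\<nu>\<in>up_nbrs \<mu>. \<Sum>\<rho>\<in>R. if \<rho> \<in> down_nbrs \<nu> then f \<rho> else 0)"
    by (intro sum.cong refl restrict) (auto simp: R_def)
  also have "\<dots> = (\<Sum>\<rho>\<in>R. card (up_nbrs \<mu> \<inter> up_nbrs \<rho>) * f \<rho>)"
    using assms up by (subst sum.swap) (simp add: sum.If_cases finite_up_nbrs)
  also have "\<dots> = card (up_nbrs \<mu>) * f \<mu> + (\<Sum>\<rho>\<in>R - {\<mu>}. card (up_nbrs \<mu> \<inter> up_nbrs \<rho>) * f \<rho>)"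
    using fin by (subst sum.remove[of _ \<mu>]) (auto simp: R_def)
  also have "(\<Sum>\<rho>\<in>R - {\<mu>}. card (up_nbrs \<mu> \<inter> up_nbrs \<rho>) * f \<rho>)
      = (\<Sum>\<rho>\<in>R - {\<mu>}. card (down_nbrs \<mu> \<inter> down_nbrs \<rho>) * f \<rho>)"
    using card_common_nbrs assms part by (intro sum.cong) (auto simp del: Int_iff)
  also have "card (up_nbrs \<mu>) * f \<mu> + \<dots> = f \<mu> + (\<Sum>\<rho>\<in>R. card (down_nbrs \<mu> \<inter> down_nbrs \<rho>) * f \<rho>)"
    using fin assms by (subst (2) sum.remove[of _ \<mu>]) (auto simp: R_def card_up_nbrs)
  also have "(\<Sum>\<rho>\<in>R. card (down_nbrs \<mu> \<inter> down_nbrs \<rho>) * f \<rho>)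
      = (\<Sum>\<nu>\<in>down_nbrs \<mu>. \<Sum>\<rho>\<in>R. if \<rho> \<in> up_nbrs \<nu> then f \<rho> else 0)"
    using assms down by (subst sum.swap) (simp add: sum.If_cases finite_down_nbrs)
  also have "\<dots> = (\<Sum>\<nu>\<in>down_nbrs \<mu>. \<Sum>\<rho>\<in>up_nbrs \<nu>. f \<rho>)"
    by (intro sum.cong refl restrict[symmetric]) (auto simp: R_def)
  finally show ?thesis .
qed

text \<open>Expanding each upper neighbour downwards and commuting yields one copy of
  \<open>num_syt \<mu>\<close>; the induction hypothesis supplies the other
  \<open>sum_list \<mu>\<close> copies.\<close>

lemma sum_up_num_syt:
  assumes "is_partition \<mu>"
  shows "(\<Sum>\<nu>\<in>up_nbrs \<mu>. num_syt \<nu>) = Suc (sum_list \<mu>) * num_syt \<mu>"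
  using assms
proof (induction "sum_list \<mu>" arbitrary: \<mu> rule: less_induct)
  case less
  have "\<nu> \<noteq> []" if "\<nu> \<in> up_nbrs \<mu>" for \<nu>
    using up_nbrs_size[OF that] by auto
  then have "(\<Sum>\<nu>\<in>up_nbrs \<mu>. num_syt \<nu>) = (\<Sum>\<nu>\<in>up_nbrs \<mu>. \<Sum>\<rho>\<in>down_nbrs \<nu>. num_syt \<rho>)"
    using up_nbrs_partition by (intro sum.cong refl num_syt_eq_sum_down) auto
  also have "\<dots> = num_syt \<mu> + (\<Sum>\<nu>\<in>down_nbrs \<mu>. \<Sum>\<rho>\<in>up_nbrs \<nu>. num_syt \<rho>)"
    by (rule sum_up_down_swap[OF less.prems])
  also have "(\<Sum>\<nu>\<in>down_nbrs \<mu>. \<Sum>\<rho>\<in>up_nbrs \<nu>. num_syt \<rho>) = (\<Sum>\<nu>\<in>down_nbrs \<mu>. sum_list \<mu> * num_syt \<nu>)"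
    using less.hyps down_nbrs_size[of _ \<mu>] down_nbrs_partition by (intro sum.cong refl) auto
  also have "\<dots> = sum_list \<mu> * num_syt \<mu>"
    using num_syt_eq_sum_down[OF less.prems]
    by (cases "\<mu> = []") (simp_all flip: sum_distrib_left)
  finally show ?case by simp
qed

text \<open>The last hypothesis is itself the instance \<open>m = 0\<close>, \<open>g = 1\<close> of the lemma, where it is trivial.\<close>

lemma sum_tableaux_eq_coeff:
  assumes "is_partition \<mu>"
    and "\<And>k. coeff P k = g k * coeff (hpoly m) k"
    and "\<And>\<mu>. is_partition \<mu> \<Longrightarrow>
      real (card (oscillating_tableaux \<mu> m)) = real (num_syt \<mu>) * coeff (hpoly m) (sum_list \<mu>)"
  shows "(\<Sum>T\<in>oscillating_tableaux \<mu> (m + r). g (sum_list (T ! m)))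
    = real (num_syt \<mu>) * coeff ((walk_op ^^ r) P) (sum_list \<mu>)"
  using assms(1)
proof (induction r arbitrary: \<mu>)
  case 0
  have "(\<Sum>T\<in>oscillating_tableaux \<mu> m. g (sum_list (T ! m))) = (\<Sum>T\<in>oscillating_tableaux \<mu> m. g (sum_list \<mu>))"
    by (intro sum.cong refl) (auto simp: oscillating_tableaux_def)
  then show ?case by (simp add: assms(2,3) 0)
next
  case (Suc r)
  let ?c = "coeff ((walk_op ^^ r) P)" and ?k = "sum_list \<mu>"
  have nth: "(T @ [\<mu>]) ! m = T ! m" if "T \<in> oscillating_tableaux \<nu> (m + r)" for T \<nu>
    using that by (auto simp: oscillating_tableaux_def nth_append)
  \<comment> \<open>The last step is peeled off. Larger predecessors read the coefficient at
    \<open>Suc ?k\<close>, with factor \<open>Suc ?k\<close> from \<open>sum_up_num_syt\<close>: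
    this is \<open>d/dx\<close>. Smaller ones give multiplication by \<open>x\<close>.\<close>
  have "(\<Sum>T\<in>oscillating_tableaux \<mu> (m + Suc r). g (sum_list (T ! m))) =
     (\<Sum>\<nu>\<in>up_nbrs \<mu>. real (num_syt \<nu>) * ?c (sum_list \<nu>)) +
     (\<Sum>\<nu>\<in>down_nbrs \<mu>. real (num_syt \<nu>) * ?c (sum_list \<nu>))"
    unfolding add_Suc_right sum_oscillating_tableaux_Suc[OF Suc.prems]
    using Suc.IH up_nbrs_partition down_nbrs_partition
    by (intro arg_cong2[where f = "(+)"] sum.cong refl) (simp_all add: nth)
  also have "(\<Sum>\<nu>\<in>up_nbrs \<mu>. real (num_syt \<nu>) * ?c (sum_list \<nu>)) = real (\<Sum>\<nu>\<in>up_nbrs \<mu>. num_syt \<nu>) * ?c (Suc ?k)"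
    unfolding of_nat_sum sum_distrib_right using up_nbrs_size by (intro sum.cong refl) simp
  also have "\<dots> = real (num_syt \<mu>) * (real (Suc ?k) * ?c (Suc ?k))"
    by (simp add: sum_up_num_syt[OF Suc.prems] algebra_simps)
  also have "(\<Sum>\<nu>\<in>down_nbrs \<mu>. real (num_syt \<nu>) * ?c (sum_list \<nu>)) = real (\<Sum>\<nu>\<in>down_nbrs \<mu>. num_syt \<nu>) * ?c (?k - 1)"
    unfolding of_nat_sum sum_distrib_right using down_nbrs_size by (intro sum.cong refl) simp
  \<comment> \<open>The empty partition has no smaller neighbour, matching the zero constant term of
    \<open>pCons 0\<close>.\<close>
  also have "\<dots> = real (num_syt \<mu>) * (if ?k = 0 then 0 else ?c (?k - 1))"
    using num_syt_eq_sum_down[OF Suc.prems] partition_size_0_iff[OF Suc.prems]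
    by (cases "\<mu> = []") (simp_all del: sum_list_eq_0_iff of_nat_sum)
  finally show ?case by (simp add: coeff_walk_op algebra_simps)
qed

lemma card_oscillating_tableaux:
  assumes "is_partition \<mu>"
  shows "real (card (oscillating_tableaux \<mu> l)) = real (num_syt \<mu>) * coeff (hpoly l) (sum_list \<mu>)"
proof -
  have "real (card (oscillating_tableaux \<nu> 0)) = real (num_syt \<nu>) * coeff (hpoly 0) (sum_list \<nu>)"
    if "is_partition \<nu>" for \<nu>
    using partition_size_0_iff[OF that] by (cases "\<nu> = []") (auto simp: hpoly_def oscillating_tableaux_0)
  then show ?thesis
    using sum_tableaux_eq_coeff[where P = 1 and g = "\<lambda>_. 1" and m = 0 and r = l, OF assms]
    by (simp add: hpoly_def)
qed

text \<open>The weight at index \<open>m\<close> turns \<open>hpoly m\<close> into a multiple of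
  \<open>x^a hpoly (m - a)\<close>; the other \<open>r\<close> steps are then moved past
  \<open>x^a\<close>.\<close>

lemma sum_tableaux_choose:
  assumes "is_partition \<mu>"
  shows "(\<Sum>T\<in>oscillating_tableaux \<mu> (m + r). real (sum_list (T ! m) choose a)) =
    real (num_syt \<mu>) * (real (m choose a) *
      (\<Sum>s\<le>a. real ((a choose s) * fact s * (r choose s)) *
        coeff (monom 1 (a - s) * hpoly (m - a + (r - s))) (sum_list \<mu>)))"
proof -
  have "(\<Sum>T\<in>oscillating_tableaux \<mu> (m + r). real (sum_list (T ! m) choose a)) =
      real (num_syt \<mu>) * coeff ((walk_op ^^ r) (smult (real (m choose a)) (monom 1 a * hpoly (m - a)))) (sum_list \<mu>)"
    by (rule sum_tableaux_eq_coeff[OF assms])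
      (simp_all add: choose_coeff_hpoly card_oscillating_tableaux)
  also have "(walk_op ^^ (r - s)) (hpoly (m - a)) = hpoly (m - a + (r - s))" for s
    by (simp add: hpoly_def add.commute[of "m - a"] funpow_add)
  ultimately show ?thesis
    by (simp add: walk_op_pow_smult walk_op_pow_monom coeff_sum)
qed

lemma card_oscillating_tableaux_pos:
  assumes "is_partition \<mu>"
  shows "0 < card (oscillating_tableaux \<mu> (sum_list \<mu> + 2 * n))"
proof -
  have "0 < real (num_syt \<mu>) * coeff (hpoly (sum_list \<mu> + 2 * n)) (sum_list \<mu>)"
    using num_syt_pos[OF assms] by (simp add: coeff_hpoly)
  then show ?thesis
    unfolding card_oscillating_tableaux[OF assms, symmetric] by linarith
qed

section \<open>Binomial moments\<close>

text \<open>Combinatorially, a choice of \<open>a + b + 1\<close> among \<open>l + 1\<close> points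
  is classified by the position \<open>m\<close> of the chosen point with \<open>a\<close> chosen
  points before it.\<close>

lemma choose_convolution:
  "(\<Sum>m\<le>l. (m choose a) * (l - m choose b)) = Suc l choose Suc (a + b)"
proof (induction b arbitrary: l)
  case 0
  show ?case using sum_choose_upper[of a l] by (simp add: atLeast0AtMost del: binomial_Suc_Suc)
next
  case (Suc b)
  show ?case
  proof (induction l)
    case 0
    show ?case by simp
  next
    case (Suc l)
    \<comment> \<open>Pascal's rule in the second factor; the term \<open>m = Suc l\<close> vanishes
      since \<open>0 choose Suc b\<close> is zero.\<close>
    have "(\<Sum>m\<le>Suc l. (m choose a) * (Suc l - m choose Suc b))
        = (\<Sum>m\<le>l. (m choose a) * (l - m choose b)) + (\<Sum>m\<le>l. (m choose a) * (l - m choose Suc b))"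
      by (simp add: Suc_diff_le algebra_simps sum.distrib)
    also have "\<dots> = Suc (Suc l) choose Suc (a + Suc b)"
      unfolding \<open>\<And>l. (\<Sum>m\<le>l. (m choose a) * (l - m choose b)) = Suc l choose Suc (a + b)\<close> Suc
      by (subst binomial_Suc_Suc) simp
    finally show ?case .
  qed
qed

text \<open>Split \<open>m\<close> as \<open>(m - a) + a\<close>; the first part is absorbed into
  the next binomial coefficient.\<close>

lemma mult_choose_self: "m * (m choose a) = Suc a * (m choose Suc a) + a * (m choose a)"
proof (cases "a \<le> m")
  case True
  have "Suc a * (m choose Suc a) = (m - a) * (m choose a)"
    using binomial_absorption[of a m] binomial_absorb_comp[of m a] by simp
  then show ?thesis using True by (simp flip: distrib_right)
qed (simp add: binomial_eq_0)

lemma tendsto_choose_over_power: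
  "(\<lambda>l. real (l choose a) / real l ^ a) \<longlonglongrightarrow> 1 / fact a"
proof (induction a)
  case (Suc a)
  have "(\<lambda>l. real (l choose a) / real l ^ a * (1 - real a / real l) / real (Suc a))
      \<longlonglongrightarrow> 1 / fact a * (1 - 0) / real (Suc a)"
    by (intro tendsto_intros Suc lim_const_over_n) simp
  moreover have "\<forall>\<^sub>F l in sequentially. real (l choose a) / real l ^ a * (1 - real a / real l) / real (Suc a)
      = real (l choose Suc a) / real l ^ Suc a"
    using eventually_gt_at_top[of 0]
  proof eventually_elim
    case (elim l)
    have "real l * real (l choose a) = real (Suc a) * real (l choose Suc a) + real a * real (l choose a)"
      using mult_choose_self[of l a] by (metis of_nat_add of_nat_mult)
    moreover have "x / L ^ a * (1 - A / L) / c = y / L ^ Suc a"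
      if "L * x = c * y + A * x" "L > 0" "c > 0" for x y c L A :: real
    proof -
      have "x / L ^ a * (1 - A / L) / c = (L * x - A * x) / (c * L ^ Suc a)"
        using that by (simp add: field_simps)
      then show ?thesis using that by simp
    qed
    ultimately show ?case using elim by simp
  qed
  ultimately have "(\<lambda>l. real (l choose Suc a) / real l ^ Suc a) \<longlonglongrightarrow> 1 / fact a * (1 - 0) / real (Suc a)"
    by (rule Lim_transform_eventually)
  then show ?case by (simp add: mult.commute)
qed simp

lemma tendsto_Suc_choose_over_power:
  "(\<lambda>l. real (Suc l choose a) / real l ^ a) \<longlonglongrightarrow> 1 / fact a"
proof -
  have "(\<lambda>l. real (Suc l choose a) / real (Suc l) ^ a * (1 + 1 / real l) ^ a) \<longlonglongrightarrow> 1 / fact a * (1 + 0) ^ a"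
    by (rule tendsto_mult[OF LIMSEQ_Suc[OF tendsto_choose_over_power]
          tendsto_power[OF tendsto_add[OF tendsto_const lim_const_over_n]]])
  moreover have "\<forall>\<^sub>F l in sequentially. real (Suc l choose a) / real (Suc l) ^ a * (1 + 1 / real l) ^ a
      = real (Suc l choose a) / real l ^ a"
    using eventually_gt_at_top[of 0]
  proof eventually_elim
    case (elim l)
    then have "1 + 1 / real l = real (Suc l) / real l" by (simp add: field_simps)
    then show ?case by (simp add: power_divide del: of_nat_Suc)
  qed
  ultimately show ?thesis by (simp add: Lim_transform_eventually)
qed

text \<open>The limit is the integral of \<open>x^(a + q) (1 - x)^b / (a! b!)\<close> over the unit
  interval. The case \<open>q = 0\<close> is an exact convolution, and
  \<open>mult_choose_self\<close> removes the powers of \<open>m\<close> one at a time.\<close>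

lemma tendsto_choose_moments:
  "(\<lambda>l. (\<Sum>m\<le>l. real m ^ q * real (m choose a) * real (l - m choose b)) / real l ^ (q + a + b + 1))
    \<longlonglongrightarrow> fact (a + q) / (fact a * fact (a + q + b + 1))"
proof (induction q arbitrary: a)
  case 0
  have "(\<Sum>m\<le>l. real m ^ 0 * real (m choose a) * real (l - m choose b)) = real (Suc l choose Suc (a + b))" for l
    unfolding choose_convolution[symmetric] by simp
  then show ?case using tendsto_Suc_choose_over_power[of "Suc (a + b)"] by (simp del: binomial_Suc_Suc)
next
  case (Suc q)
  define W where "W q a l = (\<Sum>m\<le>l. real m ^ q * real (m choose a) * real (l - m choose b))" for q a l
  have rec: "W (Suc q) a l = real (Suc a) * W q (Suc a) l + real a * W q a l" for l
    unfolding W_def sum_distrib_left sum.distrib[symmetric]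
  proof (intro sum.cong refl)
    fix m
    have "real m * real (m choose a) = real (Suc a) * real (m choose Suc a) + real a * real (m choose a)"
      using mult_choose_self[of m a] by (metis of_nat_add of_nat_mult)
    then have "real m ^ q * (real m * real (m choose a)) * real (l - m choose b) =
        real m ^ q * (real (Suc a) * real (m choose Suc a) + real a * real (m choose a)) * real (l - m choose b)"
      by simp
    then show "real m ^ Suc q * real (m choose a) * real (l - m choose b) =
      real (Suc a) * (real m ^ q * real (m choose Suc a) * real (l - m choose b)) +
      real a * (real m ^ q * real (m choose a) * real (l - m choose b))"
      by (simp only: power_Suc algebra_simps)
  qed
  have "(\<lambda>l. real (Suc a) * (W q (Suc a) l / real l ^ (q + Suc a + b + 1)) +
       real a * (W q a l / real l ^ (q + a + b + 1)) * (1 / real l))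
    \<longlonglongrightarrow> real (Suc a) * (fact (Suc a + q) / (fact (Suc a) * fact (Suc a + q + b + 1))) +
       real a * (fact (a + q) / (fact a * fact (a + q + b + 1))) * 0"
    unfolding W_def by (intro tendsto_intros Suc lim_const_over_n)
  \<comment> \<open>At \<open>l = 0\<close> both sides are zero because division by zero is zero, so
    the identity holds for every \<open>l\<close>.\<close>
  moreover have "real (Suc a) * (W q (Suc a) l / real l ^ (q + Suc a + b + 1)) +
       real a * (W q a l / real l ^ (q + a + b + 1)) * (1 / real l) = W (Suc q) a l / real l ^ (Suc q + a + b + 1)" for l
    unfolding rec add_divide_distrib by simp
  moreover have "real (Suc a) * (fact (Suc a + q) / (fact (Suc a) * fact (Suc a + q + b + 1))) +
       real a * (fact (a + q) / (fact a * fact (a + q + b + 1))) * 0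
     = (fact (a + Suc q) / (fact a * fact (a + Suc q + b + 1)) :: real)"
  proof -
    have "real (Suc a) * (x / (fact (Suc a) * y)) = x / (fact a * y)" for x y :: real
      by (simp add: fact_Suc del: of_nat_Suc)
    then show ?thesis by (simp only: mult_zero_right add_0_right add_Suc add_Suc_right)
  qed
  ultimately show ?case unfolding W_def by (simp only:)
qed

lemma tendsto_sum_powers:
  "(\<lambda>l. (\<Sum>m\<le>l. real m ^ q) / real l ^ (q + 1)) \<longlonglongrightarrow> 1 / real (q + 1)"
proof -
  have "fact q / fact (q + 1) = 1 / real (q + 1)" by simp
  then show ?thesis using tendsto_choose_moments[of q 0 0] by simp
qed

section \<open>Large partitions\<close>

text \<open>The bounds hold for each tableau separately and survive averaging because the number of
  tableaux is positive.\<close>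

lemma average_wt_bounds:
  assumes "is_partition \<mu>"
  shows "(\<Sum>m\<le>sum_list \<mu>. real m ^ (i + j)) \<le> average_wt i j \<mu> (sum_list \<mu> + 2 * n)"
    and "average_wt i j \<mu> (sum_list \<mu> + 2 * n) \<le> (\<Sum>m\<le>sum_list \<mu> + 2 * n. real m ^ (i + j))"
proof -
  let ?k = "sum_list \<mu>"
  let ?l = "?k + 2 * n"
  let ?O = "oscillating_tableaux \<mu> ?l"
  note pos = card_oscillating_tableaux_pos[OF assms, of n]
  have wt: "wt i j T = (\<Sum>m\<le>?l. sum_list (T ! m) ^ i * m ^ j)" if "T \<in> ?O" for T
    using that by (simp add: wt_def oscillating_tableaux_def lessThan_Suc_atMost)
  have up: "wt i j T \<le> (\<Sum>m\<le>?l. m ^ (i + j))" if "T \<in> ?O" for T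
    unfolding wt[OF that] power_add using oscillating_tableaux_size_bounds(1)[OF that]
    by (intro sum_mono mult_right_mono power_mono) auto
  have lo: "(\<Sum>m\<le>?k. m ^ (i + j)) \<le> wt i j T" if "T \<in> ?O" for T
  proof -
    \<comment> \<open>The lower bound keeps only the indices from \<open>2 * n\<close> on, where the
      size is at least \<open>?k - (?l - m) = m - 2 * n\<close>.\<close>
    have "(\<Sum>m\<le>?k. m ^ (i + j)) = (\<Sum>m\<in>{2 * n..?l}. (m - 2 * n) ^ (i + j))"
      by (rule sum.reindex_bij_witness[of _ "\<lambda>m. m - 2 * n" "\<lambda>m. m + 2 * n"]) auto
    also have "\<dots> \<le> (\<Sum>m\<in>{2 * n..?l}. sum_list (T ! m) ^ i * m ^ j)"
    proof (intro sum_mono)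
      fix m assume m: "m \<in> {2 * n..?l}"
      then have "m - 2 * n \<le> sum_list (T ! m)"
        using oscillating_tableaux_size_bounds(2)[OF that, of m] by auto
      then show "(m - 2 * n) ^ (i + j) \<le> sum_list (T ! m) ^ i * m ^ j"
        unfolding power_add by (intro mult_mono power_mono) auto
    qed
    also have "\<dots> \<le> wt i j T"
      unfolding wt[OF that] by (intro sum_mono2) auto
    finally show ?thesis .
  qed
  have "real (card ?O) * real (\<Sum>m\<le>?k. m ^ (i + j)) \<le> (\<Sum>T\<in>?O. real (wt i j T))"
    by (rule sum_bounded_below) (use lo in \<open>simp only: of_nat_le_iff\<close>)
  then show "(\<Sum>m\<le>?k. real m ^ (i + j)) \<le> average_wt i j \<mu> ?l"
    using pos by (simp add: average_wt_def field_simps)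
  have "(\<Sum>T\<in>?O. real (wt i j T)) \<le> real (card ?O) * real (\<Sum>m\<le>?l. m ^ (i + j))"
    by (rule sum_bounded_above) (use up in \<open>simp only: of_nat_le_iff\<close>)
  then show "average_wt i j \<mu> ?l \<le> (\<Sum>m\<le>?l. real m ^ (i + j))"
    using pos by (simp add: average_wt_def field_simps)
qed

lemma filterlim_large_partitions: "filterlim sum_list at_top large_partitions"
  unfolding large_partitions_def
  by (rule filterlim_mono[OF filterlim_filtercomap _ inf_le1]) simp

lemma average_wt_large_partitions:
  "(\<lambda>\<mu>. average_wt i j \<mu> (sum_list \<mu> + 2 * n)) \<sim>[large_partitions]
    (\<lambda>\<mu>. real (sum_list \<mu>) ^ (i + j + 1) / real (i + j + 1))"
proof (rule asymp_equivI')
  define p where "p = i + j"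
  define S where "S l = (\<Sum>m\<le>l. real m ^ p)" for l
  define c where "c = real (p + 1)"
  have c: "c > 0" by (simp add: c_def)
  have lim: "(\<lambda>l. S l / real l ^ (p + 1)) \<longlonglongrightarrow> 1 / c"
    unfolding S_def c_def by (rule tendsto_sum_powers)
  have lo: "(\<lambda>k. c * (S k / real k ^ (p + 1))) \<longlonglongrightarrow> 1"
    using tendsto_mult[OF tendsto_const lim, of c] c by simp
  \<comment> \<open>The last factor tends to \<open>1\<close> and changes the normalisation from
    powers of \<open>k + 2 * n\<close> to powers of \<open>k\<close>.\<close>
  have "(\<lambda>k. c * (S (k + 2 * n) / real (k + 2 * n) ^ (p + 1)) * (1 + real (2 * n) / real k) ^ (p + 1))
      \<longlonglongrightarrow> c * (1 / c) * (1 + 0) ^ (p + 1)"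
    by (rule tendsto_mult[OF tendsto_mult[OF tendsto_const LIMSEQ_ignore_initial_segment[OF lim]]
          tendsto_power[OF tendsto_add[OF tendsto_const lim_const_over_n]]])
  moreover have "\<forall>\<^sub>F k in sequentially. c * (S (k + 2 * n) / real (k + 2 * n) ^ (p + 1)) * (1 + real (2 * n) / real k) ^ (p + 1)
      = c * (S (k + 2 * n) / real k ^ (p + 1))"
    using eventually_gt_at_top[of 0]
  proof eventually_elim
    case (elim k)
    then have "1 + real (2 * n) / real k = real (k + 2 * n) / real k" by (simp add: field_simps)
    then show ?case using elim by (simp only: power_divide) simp
  qed
  ultimately have hi: "(\<lambda>k. c * (S (k + 2 * n) / real k ^ (p + 1))) \<longlonglongrightarrow> 1"
    using c by (simp add: Lim_transform_eventually)
  have ev: "\<forall>\<^sub>F \<mu> in large_partitions. is_partition \<mu> \<and> sum_list \<mu> > 0"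
    unfolding eventually_large_partitions by (intro exI[of _ 1]) auto
  show "((\<lambda>\<mu>. average_wt i j \<mu> (sum_list \<mu> + 2 * n) / (real (sum_list \<mu>) ^ (i + j + 1) / real (i + j + 1))) \<longlongrightarrow> 1) large_partitions"
  proof (rule tendsto_sandwich)
    show "((\<lambda>\<mu>. c * (S (sum_list \<mu>) / real (sum_list \<mu>) ^ (p + 1))) \<longlongrightarrow> 1) large_partitions"
      by (rule filterlim_compose[OF lo filterlim_large_partitions])
    show "((\<lambda>\<mu>. c * (S (sum_list \<mu> + 2 * n) / real (sum_list \<mu>) ^ (p + 1))) \<longlongrightarrow> 1) large_partitions"
      by (rule filterlim_compose[OF hi filterlim_large_partitions])
    show "\<forall>\<^sub>F \<mu> in large_partitions. c * (S (sum_list \<mu>) / real (sum_list \<mu>) ^ (p + 1))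
       \<le> average_wt i j \<mu> (sum_list \<mu> + 2 * n) / (real (sum_list \<mu>) ^ (i + j + 1) / real (i + j + 1))"
      using ev
    proof eventually_elim
      case (elim \<mu>)
      then have "c * S (sum_list \<mu>) / real (sum_list \<mu>) ^ (p + 1)
          \<le> c * average_wt i j \<mu> (sum_list \<mu> + 2 * n) / real (sum_list \<mu>) ^ (p + 1)"
        using average_wt_bounds(1)[of \<mu> i j n] c
        by (intro divide_right_mono mult_left_mono) (auto simp: S_def p_def)
      then show ?case by (simp add: c_def p_def mult.commute)
    qed
    show "\<forall>\<^sub>F \<mu> in large_partitions. average_wt i j \<mu> (sum_list \<mu> + 2 * n) / (real (sum_list \<mu>) ^ (i + j + 1) / real (i + j + 1))
       \<le> c * (S (sum_list \<mu> + 2 * n) / real (sum_list \<mu>) ^ (p + 1))"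
      using ev
    proof eventually_elim
      case (elim \<mu>)
      then have "c * average_wt i j \<mu> (sum_list \<mu> + 2 * n) / real (sum_list \<mu>) ^ (p + 1)
          \<le> c * S (sum_list \<mu> + 2 * n) / real (sum_list \<mu>) ^ (p + 1)"
        using average_wt_bounds(2)[of \<mu> i j n] c
        by (intro divide_right_mono mult_left_mono) (auto simp: S_def p_def)
      then show ?case by (simp add: c_def p_def mult.commute)
    qed
  qed
qed

section \<open>Long tableaux\<close>

text \<open>Powers and binomial coefficients of the size are carried together, so that powers can be
  traded one at a time until \<open>p = 0\<close>, where the coefficient formula applies.\<close>

definition tableau_moment :: "nat list \<Rightarrow> nat \<Rightarrow> nat \<Rightarrow> nat \<Rightarrow> nat \<Rightarrow> real" where
  "tableau_moment \<mu> p a q l =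
    (\<Sum>m\<le>l. \<Sum>T\<in>oscillating_tableaux \<mu> l. real m ^ q * real (sum_list (T ! m)) ^ p * real (sum_list (T ! m) choose a))
    / real (card (oscillating_tableaux \<mu> l))"

lemma average_wt_eq_moment: "average_wt i j \<mu> l = tableau_moment \<mu> i 0 j l"
proof -
  have "(\<Sum>T\<in>oscillating_tableaux \<mu> l. real (wt i j T)) =
     (\<Sum>T\<in>oscillating_tableaux \<mu> l. \<Sum>m\<le>l. real m ^ j * real (sum_list (T ! m)) ^ i)"
    by (intro sum.cong refl)
      (simp add: wt_def oscillating_tableaux_def lessThan_Suc_atMost mult.commute)
  then show ?thesis
    by (simp add: average_wt_def tableau_moment_def sum.swap[of _ "{..l}"])
qed

lemma tableau_moment_Suc:
  "tableau_moment \<mu> (Suc p) a q l = real (Suc a) * tableau_moment \<mu> p (Suc a) q l + real a * tableau_moment \<mu> p a q l"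
proof -
  have "real m ^ q * real h ^ Suc p * real (h choose a) =
     real (Suc a) * (real m ^ q * real h ^ p * real (h choose Suc a)) + real a * (real m ^ q * real h ^ p * real (h choose a))" for m h
  proof -
    have "real h * real (h choose a) = real (Suc a) * real (h choose Suc a) + real a * real (h choose a)"
      using mult_choose_self[of h a] by (metis of_nat_add of_nat_mult)
    then have "real m ^ q * real h ^ p * (real h * real (h choose a)) =
        real m ^ q * real h ^ p * (real (Suc a) * real (h choose Suc a) + real a * real (h choose a))"
      by simp
    then show ?thesis by (simp only: power_Suc algebra_simps)
  qed
  then show ?thesis
    by (simp only: tableau_moment_def sum.distrib sum_distrib_left[symmetric] add_divide_distrib times_divide_eq_right)
qed

text \<open>The index \<open>l - a - s\<close> does not depend on \<open>m\<close>, so the sum over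
  \<open>m\<close> separates into a binomial moment; \<open>num_syt \<mu>\<close> cancels against
  the number of tableaux.\<close>

lemma tableau_moment_0:
  assumes "is_partition \<mu>" "a \<le> n" and k: "k = sum_list \<mu>" and l: "l = k + 2 * n"
  shows "tableau_moment \<mu> 0 a q l =
    (\<Sum>s\<le>a. real ((a choose s) * fact s) *
      (if k < a - s then 0 else coeff (hpoly (l - a - s)) (k - (a - s)) / coeff (hpoly l) k) *
      (\<Sum>m\<le>l. real m ^ q * real (m choose a) * real (l - m choose s)))"
proof -
  define R where "R s = (if k < a - s then 0 else coeff (hpoly (l - a - s)) (k - (a - s)))" for s
  let ?O = "oscillating_tableaux \<mu> l"
  have inner: "(\<Sum>T\<in>?O. real (sum_list (T ! m) choose a)) =
      real (num_syt \<mu>) * (\<Sum>s\<le>a. real ((a choose s) * fact s) * R s * (real (m choose a) * real (l - m choose s)))"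
    if m: "m \<le> l" for m
  proof -
    have "(\<Sum>T\<in>?O. real (sum_list (T ! m) choose a)) = real (num_syt \<mu>) * (\<Sum>s\<le>a. real (m choose a) * (real ((a choose s) * fact s * (l - m choose s)) *
        coeff (monom 1 (a - s) * hpoly (m - a + (l - m - s))) k))"
      using sum_tableaux_choose[OF assms(1), where m = m and r = "l - m" and a = a] m by (simp add: k sum_distrib_left)
    also have "(\<Sum>s\<le>a. real (m choose a) * (real ((a choose s) * fact s * (l - m choose s)) *
          coeff (monom 1 (a - s) * hpoly (m - a + (l - m - s))) k))
        = (\<Sum>s\<le>a. real ((a choose s) * fact s) * R s * (real (m choose a) * real (l - m choose s)))"
    proof (intro sum.cong refl)
      fix s
      show "real (m choose a) * (real ((a choose s) * fact s * (l - m choose s)) *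
          coeff (monom 1 (a - s) * hpoly (m - a + (l - m - s))) k)
        = real ((a choose s) * fact s) * R s * (real (m choose a) * real (l - m choose s))"
      \<comment> \<open>If neither subtraction truncates, the index of \<open>hpoly\<close> is
        \<open>l - a - s\<close>; otherwise one of the two binomial coefficients is zero.\<close>
      proof (cases "a \<le> m \<and> s \<le> l - m")
        case True
        then have "m - a + (l - m - s) = l - a - s" using m by linarith
        then show ?thesis by (simp add: R_def coeff_monom_mult)
      next
        case False
        then have "(m choose a) * (l - m choose s) = 0" by (auto simp: binomial_eq_0)
        then show ?thesis by auto
      qed
    qed
    finally show ?thesis .
  qed
  have "(\<Sum>m\<le>l. \<Sum>T\<in>?O. real m ^ q * real (sum_list (T ! m)) ^ 0 * real (sum_list (T ! m) choose a))
      = (\<Sum>m\<le>l. real m ^ q * (\<Sum>T\<in>?O. real (sum_list (T ! m) choose a)))"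
    by (simp add: sum_distrib_left)
  also have "\<dots> = (\<Sum>m\<le>l. \<Sum>s\<le>a. real (num_syt \<mu>) * (real ((a choose s) * fact s) * R s *
      (real m ^ q * real (m choose a) * real (l - m choose s))))"
    by (intro sum.cong refl) (simp add: inner sum_distrib_left algebra_simps)
  also have "\<dots> = real (num_syt \<mu>) * (\<Sum>s\<le>a. real ((a choose s) * fact s) * R s *
      (\<Sum>m\<le>l. real m ^ q * real (m choose a) * real (l - m choose s)))"
    by (subst sum.swap) (simp only: sum_distrib_left)
  finally have *: "tableau_moment \<mu> 0 a q l = (\<Sum>s\<le>a. real ((a choose s) * fact s) * R s *
      (\<Sum>m\<le>l. real m ^ q * real (m choose a) * real (l - m choose s))) / coeff (hpoly l) k"
    using num_syt_pos[OF assms(1)]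
    by (simp add: tableau_moment_def card_oscillating_tableaux[OF assms(1)] k)
  show ?thesis
    unfolding * sum_divide_distrib by (intro sum.cong refl) (simp add: R_def)
qed

lemma tendsto_size_ratio: "(\<lambda>n. real (k + 2 * n) / real (2 * n)) \<longlonglongrightarrow> 1"
proof -
  have "(\<lambda>n. 1 + real k / 2 * (1 / real n)) \<longlonglongrightarrow> 1 + real k / 2 * 0"
    by (intro tendsto_intros lim_const_over_n)
  moreover have "\<forall>\<^sub>F n in sequentially. 1 + real k / 2 * (1 / real n) = real (k + 2 * n) / real (2 * n)"
    using eventually_gt_at_top[of 0] by eventually_elim (simp add: field_simps)
  ultimately show ?thesis by (simp add: Lim_transform_eventually)
qed

lemma filterlim_size: "filterlim (\<lambda>n::nat. k + 2 * n) at_top at_top"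
  by (rule filterlim_at_top_mono[OF filterlim_ident]) simp

text \<open>With \<open>l = k + 2 * n\<close>, the ratio of explicit coefficients is the limit
  constant times \<open>2^s n! / (n - s)!\<close> divided by \<open>l! / (l - a - s)!\<close>. These
  grow like \<open>(2 n)^s\<close> and \<open>l^(a + s)\<close>, leaving
  \<open>l^(-a)\<close>.\<close>

lemma tendsto_coeff_ratio:
  fixes k a s :: nat
  assumes "s \<le> a" "a - s \<le> k"
  shows "(\<lambda>n. coeff (hpoly (k + 2 * n - a - s)) (k - (a - s)) / coeff (hpoly (k + 2 * n)) k * real (k + 2 * n) ^ a)
    \<longlonglongrightarrow> fact k / fact (k - (a - s))"
proof -
  define C :: real where "C = fact k / fact (k - (a - s))"
  let ?l = "\<lambda>n. k + 2 * n"
  have "(\<lambda>n. C * (fact s * (real (n choose s) / real n ^ s)) / (real (?l n) / real (2 * n)) ^ s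
      / (fact (a + s) * (real (?l n choose (a + s)) / real (?l n) ^ (a + s)))) \<longlonglongrightarrow>
      C * (fact s * (1 / fact s)) / 1 ^ s / (fact (a + s) * (1 / fact (a + s)))"
    by (intro tendsto_intros tendsto_choose_over_power tendsto_size_ratio
        filterlim_compose[OF tendsto_choose_over_power filterlim_size]) simp_all
  moreover have "\<forall>\<^sub>F n in sequentially. C * (fact s * (real (n choose s) / real n ^ s)) / (real (?l n) / real (2 * n)) ^ s
      / (fact (a + s) * (real (?l n choose (a + s)) / real (?l n) ^ (a + s)))
      = coeff (hpoly (k + 2 * n - a - s)) (k - (a - s)) / coeff (hpoly (k + 2 * n)) k * real (k + 2 * n) ^ a"
    \<comment> \<open>Past this threshold \<open>n - s\<close> and \<open>k + 2 * n - a - s\<close>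
      do not truncate, and \<open>n\<close> is positive.\<close>
    using eventually_ge_at_top[of "Suc a"]
  proof eventually_elim
    case (elim n)
    have sn: "s \<le> n" and asl: "a + s \<le> ?l n" using elim assms by auto
    have idx: "k + 2 * n - a - s = (k - (a - s)) + 2 * (n - s)" using elim assms by linarith
    have 1: "coeff (hpoly (k + 2 * n - a - s)) (k - (a - s)) =
        fact (?l n - (a + s)) / (fact (k - (a - s)) * fact (n - s) * 2 ^ (n - s))"
      unfolding idx coeff_hpoly by (simp add: idx[symmetric])
    have 2: "fact s * real (n choose s) = fact n / fact (n - s)"
      using binomial_fact[OF sn, where 'a = real] by simp
    have 3: "fact (a + s) * real (?l n choose (a + s)) = fact (?l n) / fact (?l n - (a + s))"
      using binomial_fact[OF asl, where 'a = real] by simp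
    have pow: "(2::real) ^ n = 2 ^ s * 2 ^ (n - s)" using sn by (simp flip: power_add)
    have ln: "real (?l n) > 0" "real n > 0" using elim by auto
    have "C * (fact s * (real (n choose s) / real n ^ s)) / (real (?l n) / real (2 * n)) ^ s
      / (fact (a + s) * (real (?l n choose (a + s)) / real (?l n) ^ (a + s)))
      = C * (fact s * real (n choose s)) * 2 ^ s / (fact (a + s) * real (?l n choose (a + s))) * real (?l n) ^ a"
      using ln by (simp add: power_divide power_mult_distrib power_add field_simps)
    also have "\<dots> = coeff (hpoly (k + 2 * n - a - s)) (k - (a - s)) / coeff (hpoly (k + 2 * n)) k * real (k + 2 * n) ^ a"
      unfolding 1 2 3 coeff_hpoly pow C_def by (simp add: field_simps)
    finally show ?case .
  qed
  ultimately show ?thesis by (simp add: C_def Lim_transform_eventually)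
qed

text \<open>After normalisation the term \<open>s\<close> is of order at most
  \<open>l^(s - a)\<close>: the coefficient ratio contributes at most \<open>l^(-a)\<close> and the
  binomial moment \<open>l^(q + a + s + 1)\<close>. Only \<open>s = a\<close> survives, and its
  factor \<open>fact a\<close> cancels the one in the moment limit.\<close>

lemma tendsto_tableau_moment_0:
  assumes "is_partition \<mu>" and k: "k = sum_list \<mu>"
  shows "(\<lambda>n. tableau_moment \<mu> 0 a q (k + 2 * n) / real (k + 2 * n) ^ (a + q + 1))
     \<longlonglongrightarrow> fact (a + q) / fact (2 * a + q + 1)"
proof -
  let ?l = "\<lambda>n. k + 2 * n"
  define R where "R s n = (if k < a - s then 0 else coeff (hpoly (?l n - a - s)) (k - (a - s)) / coeff (hpoly (?l n)) k)" for s n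
  define W where "W s l = (\<Sum>m\<le>l. real m ^ q * real (m choose a) * real (l - m choose s))" for s l
  have Rlim: "(\<lambda>n. R s n * real (?l n) ^ s) \<longlonglongrightarrow> of_bool (s = a)" if "s \<le> a" for s
  proof -
    define c :: real where "c = (if k < a - s then 0 else fact k / fact (k - (a - s)))"
    have lim: "(\<lambda>n. R s n * real (?l n) ^ a) \<longlonglongrightarrow> c"
      using tendsto_coeff_ratio[OF that, of k] by (auto simp: R_def c_def)
    show ?thesis
    proof (cases "s = a")
      case True
      then show ?thesis using lim by (simp add: c_def)
    next
      case False
      have lim': "(\<lambda>n. R s n * real (?l n) ^ a * (1 / real (?l n)) ^ (a - s)) \<longlonglongrightarrow> c * 0 ^ (a - s)"
        by (intro tendsto_intros lim filterlim_compose[OF lim_const_over_n filterlim_size])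
      have "\<forall>\<^sub>F n in sequentially. R s n * real (?l n) ^ a * (1 / real (?l n)) ^ (a - s) = R s n * real (?l n) ^ s"
        using eventually_gt_at_top[of 0]
      proof eventually_elim
        case (elim n)
        have "real (?l n) ^ a = real (?l n) ^ s * real (?l n) ^ (a - s)"
          using that by (simp flip: power_add)
        moreover have "real (?l n) > 0" using elim by simp
        ultimately show ?case by (simp only: power_divide) simp
      qed
      from Lim_transform_eventually[OF lim' this] show ?thesis
        using that False by (simp add: zero_power)
    qed
  qed
  have Wlim: "(\<lambda>n. W s (?l n) / real (?l n) ^ (q + a + s + 1)) \<longlonglongrightarrow> fact (a + q) / (fact a * fact (a + q + s + 1))" for s
    unfolding W_def by (rule filterlim_compose[OF tendsto_choose_moments filterlim_size])
  have "(\<lambda>n. \<Sum>s\<le>a. real ((a choose s) * fact s) * (R s n * real (?l n) ^ s) * (W s (?l n) / real (?l n) ^ (q + a + s + 1)))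
    \<longlonglongrightarrow> (\<Sum>s\<le>a. real ((a choose s) * fact s) * of_bool (s = a) * (fact (a + q) / (fact a * fact (a + q + s + 1))))"
    by (intro tendsto_intros Rlim Wlim) simp
  moreover have "(\<Sum>s\<le>a. real ((a choose s) * fact s) * of_bool (s = a) * (fact (a + q) / (fact a * fact (a + q + s + 1))))
    = (fact (a + q) / fact (2 * a + q + 1) :: real)"
  proof -
    have "(\<Sum>s\<le>a. real ((a choose s) * fact s) * of_bool (s = a) * (fact (a + q) / (fact a * fact (a + q + s + 1))))
      = (\<Sum>s\<le>a. if s = a then fact a * (fact (a + q) / (fact a * fact (a + q + a + 1))) else 0 :: real)"
      by (intro sum.cong refl) simp
    also have "\<dots> = fact (a + q) / fact (a + q + a + 1)" by simp
    also have "a + q + a + 1 = 2 * a + q + 1" by simp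
    finally show ?thesis .
  qed
  moreover have "\<forall>\<^sub>F n in sequentially.
      (\<Sum>s\<le>a. real ((a choose s) * fact s) * (R s n * real (?l n) ^ s) * (W s (?l n) / real (?l n) ^ (q + a + s + 1)))
      = tableau_moment \<mu> 0 a q (?l n) / real (?l n) ^ (a + q + 1)"
    using eventually_ge_at_top[of "Suc a"]
  proof eventually_elim
    case (elim n)
    then have ln: "real (?l n) > 0" by simp
    have "tableau_moment \<mu> 0 a q (?l n) = (\<Sum>s\<le>a. real ((a choose s) * fact s) * R s n * W s (?l n))"
      unfolding R_def W_def using elim by (intro tableau_moment_0[where n = n] assms(1) k refl) simp
    moreover have "real ((a choose s) * fact s) * (R s n * real (?l n) ^ s) * (W s (?l n) / real (?l n) ^ (q + a + s + 1))
      = real ((a choose s) * fact s) * R s n * W s (?l n) / real (?l n) ^ (a + q + 1)" for s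
    proof -
      have "real (?l n) ^ (q + a + s + 1) = real (?l n) ^ s * real (?l n) ^ (a + q + 1)"
        by (simp only: power_add[symmetric] ac_simps)
      then show ?thesis using ln by (simp only:) (simp add: field_simps del: of_nat_add)
    qed
    ultimately show ?case by (simp only: sum_divide_distrib)
  qed
  ultimately show ?thesis by (simp add: Lim_transform_eventually)
qed

text \<open>Each traded power raises \<open>a\<close> and contributes a factor \<open>Suc a\<close>,
  up to a term one order lower. These factors multiply to
  \<open>fact (p + a) / fact a\<close>.\<close>

lemma tendsto_tableau_moment:
  assumes "is_partition \<mu>" and k: "k = sum_list \<mu>"
  shows "(\<lambda>n. tableau_moment \<mu> p a q (k + 2 * n) / real (k + 2 * n) ^ (p + a + q + 1))
     \<longlonglongrightarrow> fact (p + a) * fact (p + a + q) / (fact a * fact (2 * (p + a) + q + 1))"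
proof (induction p arbitrary: a)
  case 0
  then show ?case using tendsto_tableau_moment_0[OF assms, of a q] by simp
next
  case (Suc p)
  let ?l = "\<lambda>n. k + 2 * n"
  have "(\<lambda>n. real (Suc a) * (tableau_moment \<mu> p (Suc a) q (?l n) / real (?l n) ^ (p + Suc a + q + 1))
      + real a * (tableau_moment \<mu> p a q (?l n) / real (?l n) ^ (p + a + q + 1)) * (1 / real (?l n)))
    \<longlonglongrightarrow> real (Suc a) * (fact (p + Suc a) * fact (p + Suc a + q) / (fact (Suc a) * fact (2 * (p + Suc a) + q + 1)))
      + real a * (fact (p + a) * fact (p + a + q) / (fact a * fact (2 * (p + a) + q + 1))) * 0"
    by (intro tendsto_intros Suc filterlim_compose[OF lim_const_over_n filterlim_size])
  moreover have "real (Suc a) * (tableau_moment \<mu> p (Suc a) q (?l n) / real (?l n) ^ (p + Suc a + q + 1))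
      + real a * (tableau_moment \<mu> p a q (?l n) / real (?l n) ^ (p + a + q + 1)) * (1 / real (?l n))
      = tableau_moment \<mu> (Suc p) a q (?l n) / real (?l n) ^ (Suc p + a + q + 1)" for n
    unfolding tableau_moment_Suc add_divide_distrib by simp
  moreover have "real (Suc a) * (fact (p + Suc a) * fact (p + Suc a + q) / (fact (Suc a) * fact (2 * (p + Suc a) + q + 1)))
      + real a * (fact (p + a) * fact (p + a + q) / (fact a * fact (2 * (p + a) + q + 1))) * 0
    = (fact (Suc p + a) * fact (Suc p + a + q) / (fact a * fact (2 * (Suc p + a) + q + 1)) :: real)"
  proof -
    have "real (Suc a) * (x / (fact (Suc a) * y)) = x / (fact a * y)" for x y :: real
      by (simp add: fact_Suc del: of_nat_Suc)
    then show ?thesis by (simp only: mult_zero_right add_0_right add_Suc add_Suc_right)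
  qed
  ultimately show ?case by (simp only:)
qed

lemma average_wt_long:
  assumes "is_partition \<mu>"
  shows "(\<lambda>n. average_wt i j \<mu> (sum_list \<mu> + 2 * n)) \<sim>[at_top]
    (\<lambda>n. fact i * fact (i + j) * real (2 * n) ^ (i + j + 1) / fact (2 * i + j + 1))"
proof (rule asymp_equivI')
  let ?l = "\<lambda>n. sum_list \<mu> + 2 * n"
  define c :: real where "c = fact i * fact (i + j) / fact (2 * i + j + 1)"
  have c: "c > 0" by (simp add: c_def)
  \<comment> \<open>\<open>c\<close> is the moment limit at \<open>a = 0\<close>; the second factor
    replaces the length by \<open>2 * n\<close>.\<close>
  have "(\<lambda>n. average_wt i j \<mu> (?l n) / real (?l n) ^ (i + j + 1) * (real (?l n) / real (2 * n)) ^ (i + j + 1) / c)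
     \<longlonglongrightarrow> c * 1 ^ (i + j + 1) / c"
    using tendsto_tableau_moment[OF assms refl, of i 0 j] c tendsto_size_ratio[of "sum_list \<mu>"]
    by (intro tendsto_intros) (auto simp: average_wt_eq_moment c_def)
  moreover have "\<forall>\<^sub>F n in sequentially. average_wt i j \<mu> (?l n) / real (?l n) ^ (i + j + 1) * (real (?l n) / real (2 * n)) ^ (i + j + 1) / c
     = average_wt i j \<mu> (?l n) / (fact i * fact (i + j) * real (2 * n) ^ (i + j + 1) / fact (2 * i + j + 1))"
    using eventually_gt_at_top[of 0]
  proof eventually_elim
    case (elim n)
    then have "real (?l n) > 0" by simp
    then have "average_wt i j \<mu> (?l n) / real (?l n) ^ (i + j + 1) * (real (?l n) / real (2 * n)) ^ (i + j + 1) / c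
        = average_wt i j \<mu> (?l n) / (c * real (2 * n) ^ (i + j + 1))"
      by (simp only: power_divide) (simp add: mult.commute)
    then show ?case by (simp add: c_def)
  qed
  ultimately show "(\<lambda>n. average_wt i j \<mu> (?l n) / (fact i * fact (i + j) * real (2 * n) ^ (i + j + 1) / fact (2 * i + j + 1)))
      \<longlonglongrightarrow> 1"
    using c by (simp add: Lim_transform_eventually)
qed

theorem theorem1p7:
  fixes i j :: nat
  shows "(\<forall>n::nat.
            (\<lambda>\<mu>. average_wt i j \<mu> (sum_list \<mu> + 2 * n))
              \<sim>[large_partitions]
            (\<lambda>\<mu>. real (sum_list \<mu>) ^ (i + j + 1) / real (i + j + 1)))
       \<and> (\<forall>\<mu>. is_partition \<mu> \<longrightarrow>
            (\<lambda>n::nat. average_wt i j \<mu> (sum_list \<mu> + 2 * n))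
              \<sim>[at_top]
            (\<lambda>n. fact i * fact (i + j) * real (2 * n) ^ (i + j + 1) / fact (2 * i + j + 1)))"
  using average_wt_large_partitions average_wt_long by blast

end
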